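(* Let $p$ be an odd prime, let $q\in\mathbb{C}_p$ with $q\neq 1$ and $|1-q|_p<p^{-\frac{1}{p-1}}$, let $\lambda,t\in\mathbb{C}_p$ with $|\lambda|_p\le 1$ and $|t|_p<p^{-\frac{1}{p-1}}$, let $r\in\mathbb{N}$, $x\in\mathbb{Z}_p$ and $w_1,w_2\in\mathbb{N}$. Then \begin{align*} &\frac{1}{[w_2]_q^r} \sum_{j_1,\dots,j_r=0}^{w_2-1} q^{w_1 \sum_{l=1}^r j_l} \int_{\mathbb{Z}_p} \cdots \int_{\mathbb{Z}_p} (1+\lambda t)^{\frac{1}{\lambda}[w_1w_2x + w_1 \sum_{l=1}^r j_l + w_2 \sum_{l=1}^r y_l]_q}\, d\mu_{q^{w_2}} (y_1)\cdots d\mu_{q^{w_2}} (y_r)\\ &=\frac{1}{[w_1]_q^r} \sum_{j_1,\dots,j_r=0}^{w_1-1} q^{w_2 \sum_{l=1}^r j_l} \int_{\mathbb{Z}_p} \cdots \int_{\mathbb{Z}_p} (1+\lambda t)^{\frac{1}{\lambda}[w_1w_2x + w_2 \sum_{l=1}^r j_l + w_1 \sum_{l=1}^r y_l]_q}\, d\mu_{q^{w_1}} (y_1)\cdots d\mu_{q^{w_1}} (y_r). \end{align*}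
   Context: $\mathbb{Z}_p,\mathbb{Q}_p,\mathbb{C}_p$ denote the $p$-adic integers, $p$-adic numbers and the completion of the algebraic closure of $\mathbb{Q}_p$, with $|p|_p=1/p$. For $z\in\mathbb{Z}_p$, $[z]_q=\frac{1-q^z}{1-q}$. For $a\in\mathbb{C}_p$ define $(a)_{0,\lambda}=1$ and $(a)_{n,\lambda}=a(a-\lambda)(a-2\lambda)\cdots(a-(n-1)\lambda)$ for $n\ge1$, and $(1+\lambda t)^{a/\lambda}:=\sum_{n\ge0}(a)_{n,\lambda}\frac{t^n}{n!}$ (which equals $\sum_n\binom{a/\lambda}{n}\lambda^nt^n$ when $\lambda\neq0$). For $w\in\mathbb{N}$ and a uniformly differentiable function $f$ on $\mathbb{Z}_p$, the $p$-adic $q^w$-integral is $\int_{\mathbb{Z}_p}f(y)\,d\mu_{q^w}(y)=\lim_{N\to\infty}\frac{1}{[p^N]_{q^w}}\sum_{y=0}^{p^N-1}f(y)q^{wy}$; the multiple integral is the iterated one, i.e. $\lim_{N\to\infty}\frac{1}{[p^N]_{q^w}^r}\sum_{y_1,\dots,y_r=0}^{p^N-1}f(y_1,\dots,y_r)q^{w(y_1+\cdots+y_r)}$. *)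

theory Defs
  imports "HOL-Analysis.Analysis" "HOL-Computational_Algebra.Polynomial"
begin

text \<open>
  A field of characteristic 0, complete with respect to a non-archimedean absolute value.  The
  library's norm is tied to real vector spaces, which such a field is not, so the absolute value
  is the distance to 0; that it vanishes only at 0 comes from the metric.
\<close>

class nonarch_complete_field = field_char_0 + complete_space +
  assumes dist_diff: "dist x y = dist (x - y) 0"
    and dist_zero_mult: "dist (x * y) 0 = dist x 0 * dist y 0"
    and dist_zero_add: "dist (x + y) 0 \<le> max (dist x 0) (dist y 0)"

definition absval :: "'a::nonarch_complete_field \<Rightarrow> real" where
  "absval x = dist x 0"

text \<open>
  The p-adic numbers and p-adic integers as the completions of the rationals and of the
  integers, taken inside a complete field whose absolute value satisfies |p| = 1/p (and hence
  restricts to the p-adic one on the rationals).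
\<close>

definition padic_numbers :: "'a::nonarch_complete_field set" where
  "padic_numbers = closure \<rat>"

definition padic_integers :: "'a::nonarch_complete_field set" where
  "padic_integers = closure \<int>"

definition algebraic_over :: "'a::field set \<Rightarrow> 'a set" where
  "algebraic_over F = {z. \<exists>f. f \<noteq> 0 \<and> (\<forall>i. coeff f i \<in> F) \<and> poly f z = 0}"

text \<open>
  The type 'a is a copy of the completion of the algebraic closure of the p-adic numbers: the
  absolute value is normalised by |p| = 1/p, the elements algebraic over the p-adic numbers form
  an algebraically closed field, and that field is dense in the complete field 'a.  This
  determines 'a up to isometric isomorphism.
\<close>

definition padic_complex :: "nat \<Rightarrow> 'a::nonarch_complete_field itself \<Rightarrow> bool" where
  "padic_complex p (_ :: 'a itself) \<longleftrightarrow>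
     absval (of_nat p :: 'a) = 1 / real p \<and>
     (\<forall>f :: 'a poly. degree f > 0 \<longrightarrow>
        (\<forall>i. coeff f i \<in> algebraic_over padic_numbers) \<longrightarrow>
        (\<exists>z \<in> algebraic_over padic_numbers. poly f z = 0)) \<and>
     closure (algebraic_over padic_numbers :: 'a set) = UNIV"

text \<open>
  The power with p-adic integer exponent z, as the continuous extension of n \<mapsto> q ^ n:
  the limit of q ^ n as the natural number n tends to z p-adically.
\<close>

definition padic_power :: "'a::nonarch_complete_field \<Rightarrow> 'a \<Rightarrow> 'a" where
  "padic_power q z = Lim (filtercomap of_nat (nhds z)) (\<lambda>n::nat. q ^ n)"

definition q_number :: "'a::nonarch_complete_field \<Rightarrow> 'a \<Rightarrow> 'a" where
  "q_number q z = (1 - padic_power q z) / (1 - q)"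

definition degen_falling :: "'a::comm_ring_1 \<Rightarrow> 'a \<Rightarrow> nat \<Rightarrow> 'a" where
  "degen_falling lam a n = (\<Prod>i<n. a - of_nat i * lam)"

text \<open>The value of (1 + lam t)^(a / lam), which is meaningful for lam = 0 as well.\<close>

definition degen_exp :: "'a::nonarch_complete_field \<Rightarrow> 'a \<Rightarrow> 'a \<Rightarrow> 'a" where
  "degen_exp lam t a = (\<Sum>n. degen_falling lam a n * (t ^ n / fact n))"

text \<open>The integral with respect to \<open>\<mu>\<^sub>Q\<close>.\<close>

definition padic_q_integral ::
    "nat \<Rightarrow> 'a::nonarch_complete_field \<Rightarrow> ('a \<Rightarrow> 'a) \<Rightarrow> 'a" where
  "padic_q_integral p Q f =
     lim (\<lambda>N. 1 / q_number Q (of_nat (p ^ N)) * (\<Sum>y<p ^ N. f (of_nat y) * Q ^ y))"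

text \<open>
  The r-fold iterated integral of a function of the list of variables; the first variable is
  integrated innermost, the last one outermost.
\<close>

primrec padic_q_multi_integral ::
    "nat \<Rightarrow> 'a::nonarch_complete_field \<Rightarrow> nat \<Rightarrow> ('a list \<Rightarrow> 'a) \<Rightarrow> 'a" where
  "padic_q_multi_integral p Q 0 f = f []"
| "padic_q_multi_integral p Q (Suc r) f =
     padic_q_integral p Q (\<lambda>y. padic_q_multi_integral p Q r (\<lambda>ys. f (ys @ [y])))"

end

theory Submission
  imports Defs
begin

text \<open>
  All functions that occur depend on the integration variables only through a natural number
  \<open>m\<close>, and each side is the value at \<open>m = 0\<close> of the \<open>r\<close>-th power of an
  operator that combines a sum over one \<open>j\<close> with one integral.  On
  \<open>m \<mapsto> q\<^bsup>km\<^esup>\<close> this operator acts by the scalar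
  \<open>(k+1)(1-q)(1-q\<^bsup>ab(k+1)\<^esup>) / ((1-q\<^bsup>a(k+1)\<^esup>)(1-q\<^bsup>b(k+1)\<^esup>))\<close>,
  which is symmetric in \<open>a = w\<^sub>1\<close> and \<open>b = w\<^sub>2\<close>.  Both operators are continuous
  for the norm \<open>sup |\<Delta>\<^bsub>h\<^sub>1\<^esub> \<dots> \<Delta>\<^bsub>h\<^sub>k\<^esub> f(m)| / |h\<^sub>1 \<dots> h\<^sub>k|\<close>, so
  they agree on the closure of the exponential polynomials; the degenerate exponential lies there
  because \<open>m \<mapsto> [z + m]\<^sub>q\<close> has norm at most 1 and \<open>t\<^sup>n / n!\<close> tends to 0.
\<close>

section \<open>The absolute value\<close>

lemma dist_absval: "dist x y = absval (x - y)"
  unfolding absval_def by (rule dist_diff)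

lemma absval_nonneg [simp]: "0 \<le> absval x"
  by (simp add: absval_def)

lemma absval_eq_0_iff [simp]: "absval x = 0 \<longleftrightarrow> x = 0"
  by (simp add: absval_def)

lemma absval_pos_iff [simp]: "0 < absval x \<longleftrightarrow> x \<noteq> 0"
  using absval_nonneg[of x] absval_eq_0_iff[of x] by linarith

lemma absval_mult: "absval (x * y) = absval x * absval y"
  by (simp add: absval_def dist_zero_mult)

lemma absval_add: "absval (x + y) \<le> max (absval x) (absval y)"
  by (simp add: absval_def dist_zero_add)

lemma absval_triangle: "absval (x + y) \<le> absval x + absval y"
  using absval_add[of x y] absval_nonneg[of x] absval_nonneg[of y] by linarith

lemma absval_1 [simp]: "absval (1 :: 'a::nonarch_complete_field) = 1"
  using absval_mult[of "1::'a" 1] by simp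

lemma absval_0 [simp]: "absval 0 = 0"
  by simp

lemma absval_minus_commute: "absval (x - y) = absval (y - x)"
  by (metis dist_absval dist_commute)

lemma absval_minus [simp]: "absval (- x) = absval x"
  using absval_minus_commute[of 0 x] by simp

lemma absval_diff: "absval (x - y) \<le> max (absval x) (absval y)"
  using absval_add[of x "- y"] by simp

lemma absval_add_le: "absval x \<le> B \<Longrightarrow> absval y \<le> B \<Longrightarrow> absval (x + y) \<le> B"
  using absval_add[of x y] by linarith

lemma absval_diff_le: "absval x \<le> B \<Longrightarrow> absval y \<le> B \<Longrightarrow> absval (x - y) \<le> B"
  using absval_diff[of x y] by linarith

lemma absval_power: "absval (x ^ n) = absval x ^ n"
  by (induction n) (simp_all add: absval_mult)

lemma absval_divide: "absval (x / y) = absval x / absval y"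
proof (cases "y = 0")
  case False
  then have "absval (x / y) * absval y = absval x"
    by (simp flip: absval_mult)
  with False show ?thesis by (simp add: field_simps)
qed simp

lemma absval_sum_le:
  assumes "0 \<le> B" and "\<And>i. i \<in> A \<Longrightarrow> absval (f i) \<le> B"
  shows "absval (sum f A) \<le> B"
  using assms by (induction A rule: infinite_finite_induct) (auto intro: absval_add_le)

lemma absval_of_nat_le: "absval (of_nat n :: 'a::nonarch_complete_field) \<le> 1"
  by (induction n) (auto intro: absval_add_le)

lemma absval_of_int_le: "absval (of_int k :: 'a::nonarch_complete_field) \<le> 1"
  by (cases k) (auto simp: absval_of_nat_le simp del: of_nat_Suc)

text \<open>Isosceles principle: each of \<open>x\<close> and \<open>y\<close> is bounded by the
  maximum of the other and \<open>y - x\<close>, and \<open>y - x\<close> is too small to be that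
  maximum.\<close>

lemma absval_eqI_dominant:
  assumes "absval (y - x) < absval x"
  shows "absval y = absval x"
proof (rule antisym)
  show "absval y \<le> absval x"
    using absval_add[of x "y - x"] assms by simp
  show "absval x \<le> absval y"
    using absval_diff[of y "y - x"] assms by simp
qed

lemma tendsto_absval_iff: "(f \<longlongrightarrow> l) F \<longleftrightarrow> ((\<lambda>x. absval (f x - l)) \<longlongrightarrow> 0) F"
  by (simp add: tendsto_dist_iff[of f] dist_absval)

lemma tendsto_absvalI:
  assumes "(g \<longlongrightarrow> 0) F" and "\<And>x. absval (f x - l) \<le> g x"
  shows "(f \<longlongrightarrow> l) F"
  by (rule tendsto_absval_iff[THEN iffD2], rule Lim_null_comparison[OF _ assms(1)])
    (simp add: assms(2))

section \<open>Continuity of the field operations\<close>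

instance nonarch_complete_field \<subseteq> topological_ab_group_add
proof
  fix a b :: 'a
  let ?F = "nhds a \<times>\<^sub>F nhds b"
  have 1: "((\<lambda>x. absval (fst x - a)) \<longlongrightarrow> 0) ?F"
    by (rule tendsto_absval_iff[THEN iffD1, OF filterlim_fst])
  have 2: "((\<lambda>x. absval (snd x - b)) \<longlongrightarrow> 0) ?F"
    by (rule tendsto_absval_iff[THEN iffD1, OF filterlim_snd])
  show "LIM x ?F. fst x + snd x :> nhds (a + b)"
  proof (rule tendsto_absvalI)
    show "((\<lambda>x. absval (fst x - a) + absval (snd x - b)) \<longlongrightarrow> 0) ?F"
      using tendsto_add[OF 1 2] by simp
    show "absval (fst x + snd x - (a + b)) \<le> absval (fst x - a) + absval (snd x - b)" for x
      using absval_triangle[of "fst x - a" "snd x - b"] by (simp only: add_diff_add)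
  qed
  show "(uminus \<longlongrightarrow> - a) (nhds a)"
  proof (rule tendsto_absvalI)
    show "((\<lambda>x. absval (x - a)) \<longlongrightarrow> 0) (nhds a)"
      by (rule tendsto_absval_iff[THEN iffD1, OF filterlim_ident])
    show "absval (- x - - a) \<le> absval (x - a)" for x
      using absval_minus_commute[of a x] by simp
  qed
qed

instance nonarch_complete_field \<subseteq> topological_semigroup_mult
proof
  fix a b :: 'a
  let ?F = "nhds a \<times>\<^sub>F nhds b"
  have 1: "((\<lambda>x. absval (fst x - a)) \<longlongrightarrow> 0) ?F"
    by (rule tendsto_absval_iff[THEN iffD1, OF filterlim_fst])
  have 2: "((\<lambda>x. absval (snd x - b)) \<longlongrightarrow> 0) ?F"
    by (rule tendsto_absval_iff[THEN iffD1, OF filterlim_snd])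
  show "LIM x ?F. fst x * snd x :> nhds (a * b)"
  proof (rule tendsto_absvalI)
    show "((\<lambda>x. absval (fst x - a) * absval (snd x - b)
           + (absval (fst x - a) * absval b + absval a * absval (snd x - b))) \<longlongrightarrow> 0) ?F"
      using tendsto_add[OF tendsto_mult[OF 1 2] tendsto_add[OF
            tendsto_mult[OF 1 tendsto_const[of "absval b"]]
            tendsto_mult[OF tendsto_const[of "absval a"] 2]]]
      by simp
    fix x :: "'a \<times> 'a"
    have "fst x * snd x - a * b = (fst x - a) * (snd x - b) + ((fst x - a) * b + a * (snd x - b))"
      by (simp add: algebra_simps)
    then show "absval (fst x * snd x - a * b) \<le> absval (fst x - a) * absval (snd x - b)
           + (absval (fst x - a) * absval b + absval a * absval (snd x - b))"
      using absval_triangle[of "(fst x - a) * (snd x - b)" "(fst x - a) * b + a * (snd x - b)"]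
        absval_triangle[of "(fst x - a) * b" "a * (snd x - b)"]
      by (simp add: absval_mult)
  qed
qed

section \<open>Limits and series under the strong triangle inequality\<close>

lemma absval_le_limit:
  assumes "X \<longlonglongrightarrow> L" and "\<And>n. absval (X n) \<le> B"
  shows "absval L \<le> B"
proof -
  have "(\<lambda>n. dist (X n) 0) \<longlonglongrightarrow> dist L 0"
    by (intro tendsto_dist assms tendsto_const)
  then show ?thesis
    using assms(2) unfolding absval_def by (auto intro: LIMSEQ_le_const2)
qed

text \<open>A block of terms is bounded by its largest term, not by the sum of their sizes.
  Comparing both partial sums with the one at \<open>k\<close> avoids ordering \<open>i\<close> and
  \<open>j\<close>.\<close>

lemma partial_sum_diff_le:
  fixes f :: "nat \<Rightarrow> 'a::nonarch_complete_field"
  assumes "\<And>n. n \<ge> k \<Longrightarrow> absval (f n) \<le> B" and "0 \<le> B" and "k \<le> i" and "k \<le> j"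
  shows "absval (sum f {..<i} - sum f {..<j}) \<le> B"
proof -
  have *: "absval (sum f {..<i} - sum f {..<k}) \<le> B" if "k \<le> i" for i
  proof -
    have "sum f {..<i} - sum f {..<k} = sum f {k..<i}"
      using that by (metis (no_types) lessThan_atLeast0 sum_diff_nat_ivl zero_le)
    then show ?thesis using assms by (auto intro: absval_sum_le)
  qed
  have "sum f {..<i} - sum f {..<j}
      = (sum f {..<i} - sum f {..<k}) - (sum f {..<j} - sum f {..<k})"
    by simp
  then show ?thesis
    using absval_diff_le[OF *[OF assms(3)] *[OF assms(4)]] by simp
qed

lemma nonarch_summable:
  fixes f :: "nat \<Rightarrow> 'a::nonarch_complete_field"
  assumes "(\<lambda>n. absval (f n)) \<longlonglongrightarrow> 0"
  shows "summable f"
proof -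
  have "Cauchy (\<lambda>n. sum f {..<n})"
  proof (rule metric_CauchyI)
    fix e :: real assume "0 < e"
    \<comment> \<open>The block bound is non-strict; halving \<open>e\<close> leaves room for the
      strict inequality.\<close>
    then obtain k where k: "\<And>n. n \<ge> k \<Longrightarrow> absval (f n) < e / 2"
      using order_tendstoD(2)[OF assms, of "e / 2"] by (auto simp: eventually_sequentially)
    have "dist (sum f {..<i}) (sum f {..<j}) < e" if "i \<ge> k" "j \<ge> k" for i j
    proof -
      have "absval (sum f {..<i} - sum f {..<j}) \<le> e / 2"
        using that k \<open>0 < e\<close> by (intro partial_sum_diff_le[of k]) (auto intro: less_imp_le)
      with \<open>0 < e\<close> show ?thesis by (simp add: dist_absval)
    qed
    then show "\<exists>M. \<forall>m\<ge>M. \<forall>n\<ge>M. dist (sum f {..<m}) (sum f {..<n}) < e" by blast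
  qed
  then have "convergent (\<lambda>n. sum f {..<n})" by (rule Cauchy_convergent)
  then show ?thesis by (simp add: summable_iff_convergent)
qed

section \<open>The \<open>p\<close>-adic absolute value\<close>

text \<open>If \<open>n\<close> were also of absolute value below 1, a Bezout relation between
  \<open>p\<close> and \<open>n\<close> would force |1| < 1.\<close>

lemma absval_of_nat_coprime:
  assumes "absval (of_nat p :: 'a::nonarch_complete_field) < 1" and "coprime p n"
  shows "absval (of_nat n :: 'a) = 1"
proof -
  obtain a b where "a * int p + b * int n = 1"
    using bezout_int[of "int p" "int n"] assms(2) by (auto simp: coprime_iff_gcd_eq_1)
  then have eq: "of_int a * of_nat p + of_int b * of_nat n = (1::'a)"
    by (metis of_int_1 of_int_add of_int_mult of_int_of_nat_eq)
  show ?thesis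
  proof (rule ccontr)
    assume "absval (of_nat n :: 'a) \<noteq> 1"
    then have n: "absval (of_nat n :: 'a) < 1"
      using absval_of_nat_le[of n, where ?'a = 'a] by linarith
    have "absval (of_int a * of_nat p :: 'a) < 1" "absval (of_int b * of_nat n :: 'a) < 1"
      using assms(1) n mult_right_mono[OF absval_of_int_le[of a, where ?'a = 'a] absval_nonneg[of "of_nat p :: 'a"]]
        mult_right_mono[OF absval_of_int_le[of b, where ?'a = 'a] absval_nonneg[of "of_nat n :: 'a"]]
      by (simp_all add: absval_mult)
    then show False
      using absval_add[of "of_int a * of_nat p :: 'a" "of_int b * of_nat n"] eq by simp
  qed
qed

locale padic_base =
  fixes p :: nat and ty :: "'a::nonarch_complete_field itself"
  assumes prime_p: "prime p" and absval_p: "absval (of_nat p :: 'a) = 1 / real p"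
begin

lemma p_gt_1: "p > 1"
  using prime_p by (rule prime_gt_1_nat)

lemma absval_p_less_1: "absval (of_nat p :: 'a) < 1"
  using p_gt_1 by (simp add: absval_p)

lemma absval_p_power: "absval (of_nat (p ^ N) :: 'a) = (1 / real p) ^ N"
  by (simp add: absval_power absval_p)

lemma absval_p_power_tendsto: "(\<lambda>N. absval (of_nat (p ^ N) :: 'a)) \<longlonglongrightarrow> 0"
  unfolding absval_p_power using p_gt_1 by (intro LIMSEQ_realpow_zero) auto

text \<open>For \<open>z\<close> below this radius, the linear term of \<open>(1 + z)\<^sup>p - 1\<close>
  dominates the term \<open>z\<^sup>p\<close>.\<close>

definition radius :: real where
  "radius = real p powr (- 1 / (real p - 1))"

lemma radius: "0 < radius" "radius < 1" "radius ^ (p - 1) = 1 / real p"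
proof -
  have p1: "real (p - 1) = real p - 1" "real p - 1 > 0" using p_gt_1 by auto
  show "0 < radius" "radius < 1"
    using p1 p_gt_1 by (auto simp: radius_def intro: powr_less_one)
  then have "radius ^ (p - 1) = real p powr (- 1)"
    using p1 p_gt_1 by (simp add: powr_powr radius_def flip: powr_realpow)
  then show "radius ^ (p - 1) = 1 / real p"
    using p_gt_1 by (simp add: powr_minus_divide)
qed

section \<open>The absolute value of \<open>1 - q ^ n\<close>\<close>

lemma ball_power_less:
  assumes "absval (z :: 'a) < radius"
  shows "absval z ^ (p - 1) < 1 / real p"
  using power_strict_mono[OF assms, of "p - 1"] p_gt_1 radius(3) by simp

text \<open>Expand (1 + z)^p with z = q - 1. The middle binomial coefficients are divisible by
  \<open>p\<close>, and z^p is controlled by the radius, so the linear term p z dominates all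
  others.\<close>

lemma absval_one_minus_power_p:
  fixes q :: 'a
  assumes "absval (1 - q) < radius"
  shows "absval (1 - q ^ p) = absval (of_nat p :: 'a) * absval (1 - q)"
proof (cases "q = 1")
  case False
  define z where "z = q - 1"
  have z: "absval z = absval (1 - q)" "z \<noteq> 0" "absval z > 0"
    using False absval_minus_commute[of q 1] by (auto simp: z_def)
  have less: "absval z ^ (p - 1) < 1 / real p" "absval z < 1"
    using ball_power_less[of z] assms radius(2) by (auto simp: z(1))
  have "q ^ p = (\<Sum>k\<le>p. of_nat (p choose k) * z ^ k)"
    using binomial_ring[of z 1 p] by (simp add: z_def)
  also have "{..p} = insert 0 (insert 1 {2..p})" using p_gt_1 by auto
  finally have eq: "(q ^ p - 1) - of_nat p * z = (\<Sum>k\<in>{2..p}. of_nat (p choose k) * z ^ k)"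
    by simp
  \<comment> \<open>The first entry covers the terms 2 <= k < p, the second the term k = p.\<close>
  define B where "B = max (1 / real p * absval z ^ 2) (absval z ^ p)"
  have "absval (of_nat (p choose k) * z ^ k) \<le> B" if "k \<in> {2..p}" for k
  proof (cases "k = p")
    case True
    then show ?thesis by (simp add: B_def absval_power)
  next
    case False
    then have "p dvd (p choose k)"
      using that by (intro dvd_choose_prime) (auto simp: prime_p)
    then obtain m where "p choose k = p * m" ..
    then have "absval (of_nat (p choose k) :: 'a) \<le> 1 / real p"
      using mult_left_mono[OF absval_of_nat_le[of m, where ?'a = 'a], of "1 / real p"]
      by (simp add: absval_mult absval_p)
    moreover have "absval z ^ k \<le> absval z ^ 2"
      using that less(2) z by (intro power_decreasing) auto
    ultimately have "absval (of_nat (p choose k) * z ^ k) \<le> 1 / real p * absval z ^ 2"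
      unfolding absval_mult absval_power by (intro mult_mono) auto
    then show ?thesis by (simp add: B_def)
  qed
  then have "absval (\<Sum>k\<in>{2..p}. of_nat (p choose k) * z ^ k) \<le> B"
    by (intro absval_sum_le) (auto simp: B_def le_max_iff_disj)
  also have "B < 1 / real p * absval z"
  proof -
    have "absval z ^ p = absval z ^ (p - 1) * absval z"
      using p_gt_1 by (metis One_nat_def less_nat_zero_code neq0_conv power_minus_mult)
    moreover have "absval z * absval z < 1 * absval z"
      using less(2) z(3) by (intro mult_strict_right_mono)
    ultimately show ?thesis
      using mult_strict_right_mono[OF less(1) z(3)] z(3) p_gt_1
      by (auto simp: B_def power2_eq_square divide_strict_right_mono)
  qed
  finally have "absval ((q ^ p - 1) - of_nat p * z) < absval (of_nat p * z)"
    by (simp add: eq absval_mult absval_p)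
  then have "absval (q ^ p - 1) = absval (of_nat p * z)"
    by (rule absval_eqI_dominant)
  then show ?thesis
    using absval_minus_commute[of 1 "q ^ p"] z(1) by (simp add: absval_mult)
qed simp

text \<open>The quotient of \<open>1 - q ^ n\<close> by \<open>1 - q\<close> is a geometric sum,
  congruent to \<open>n\<close> modulo \<open>1 - q\<close>, and \<open>n\<close> is a unit.\<close>

lemma absval_one_minus_power_coprime:
  fixes q :: 'a
  assumes "absval (1 - q) < 1" and "coprime p n"
  shows "absval (1 - q ^ n) = absval (1 - q)"
proof -
  have q: "absval q = 1"
    using absval_eqI_dominant[of q 1] absval_minus_commute[of q 1] assms(1) by simp
  have "absval ((\<Sum>i<n. q ^ i) - of_nat n) \<le> absval (1 - q)"
  proof -
    have "(\<Sum>i<n. q ^ i) - of_nat n = (\<Sum>i<n. q ^ i - 1)"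
      by (simp add: sum_subtractf)
    moreover have "absval (q ^ i - 1) \<le> absval (1 - q)" for i
    proof -
      have "absval (1 - q ^ i) = absval (1 - q) * absval (\<Sum>j<i. q ^ j)"
        by (simp add: one_diff_power_eq absval_mult)
      also have "\<dots> \<le> absval (1 - q) * 1"
        by (intro mult_left_mono absval_sum_le) (auto simp: absval_power q)
      finally show ?thesis by (simp add: absval_minus_commute[of "q ^ i"])
    qed
    ultimately show ?thesis by (simp add: absval_sum_le)
  qed
  moreover have n: "absval (of_nat n :: 'a) = 1"
    using absval_of_nat_coprime[OF absval_p_less_1 assms(2)] .
  ultimately have "absval (\<Sum>i<n. q ^ i) = 1"
    using absval_eqI_dominant[of "\<Sum>i<n. q ^ i" "of_nat n"] assms(1) by simp
  then show ?thesis
    by (simp add: one_diff_power_eq absval_mult)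
qed

text \<open>Factors \<open>p\<close> of \<open>n\<close> are removed one at a time by passing from
  \<open>q\<close> to \<open>q ^ p\<close>, which stays in the ball; hence the induction is over all
  \<open>q\<close>. What remains is coprime to \<open>p\<close>.\<close>

lemma absval_one_minus_power:
  fixes q :: 'a
  assumes "absval (1 - q) < radius"
  shows "absval (1 - q ^ n) = absval (of_nat n :: 'a) * absval (1 - q)"
  using assms
proof (induction n arbitrary: q rule: less_induct)
  case (less n)
  consider "n = 0" | "coprime p n" | m where "n = p * m" "0 < m" "m < n"
  proof (cases "p dvd n \<and> n \<noteq> 0")
    case True
    then obtain m where "n = p * m" "0 < m" by (auto elim!: dvdE)
    with p_gt_1 that(3) show ?thesis by simp
  qed (use prime_p prime_imp_coprime that in blast)
  then show ?case
  proof cases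
    case 2
    then show ?thesis
      using absval_one_minus_power_coprime[of q n] less.prems radius(2)
        absval_of_nat_coprime[OF absval_p_less_1] by simp
  next
    case 3
    have *: "absval (1 - q ^ p) = absval (of_nat p :: 'a) * absval (1 - q)"
      by (rule absval_one_minus_power_p[OF less.prems])
    also have "\<dots> \<le> 1 * absval (1 - q)"
      by (intro mult_right_mono absval_of_nat_le) auto
    finally have "absval (1 - q ^ p) < radius"
      using less.prems by simp
    from less.IH[OF 3(3) this] show ?thesis
      by (simp add: 3(1) power_mult * absval_mult)
  qed simp
qed

section \<open>The size of factorials\<close>

lemma absval_fact_p_mult_add:
  "i < p \<Longrightarrow> absval (fact (p * m + i) :: 'a) = absval (fact (p * m) :: 'a)"
proof (induction i)
  case (Suc i)
  \<comment> \<open>No number strictly between two consecutive multiples of \<open>p\<close> is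
    divisible by \<open>p\<close>, so the new factor is a unit.\<close>
  have "\<not> p dvd p * m + Suc i"
    using Suc.prems by (metis dvd_add_right_iff dvd_triv_left nat_dvd_not_less zero_less_Suc)
  then have "coprime p (p * m + Suc i)"
    using prime_p prime_imp_coprime by blast
  then have "absval (of_nat (p * m + Suc i) :: 'a) = 1"
    by (rule absval_of_nat_coprime[OF absval_p_less_1])
  moreover have "fact (p * m + Suc i) = of_nat (p * m + Suc i) * (fact (p * m + i) :: 'a)"
    by (simp only: add_Suc_right fact_Suc)
  ultimately show ?case using Suc by (simp add: absval_mult)
qed simp

text \<open>Among the \<open>p\<close> factors gained when \<open>m\<close> grows by one, only the
  last, \<open>p * Suc m\<close>, is not a unit.\<close>

lemma absval_fact_p_mult: "absval (fact (p * m) :: 'a) = (1 / real p) ^ m * absval (fact m :: 'a)"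
proof (induction m)
  case (Suc m)
  have "p * Suc m = Suc (p * m + (p - 1))" using p_gt_1 by simp
  then have "(fact (p * Suc m) :: 'a) = of_nat (p * Suc m) * fact (p * m + (p - 1))"
    by (metis fact_Suc)
  then have "absval (fact (p * Suc m) :: 'a)
      = absval (of_nat (p * Suc m) :: 'a) * absval (fact (p * m) :: 'a)"
    using absval_fact_p_mult_add[of "p - 1"] p_gt_1 by (simp add: absval_mult)
  then show ?case
    by (simp add: Suc absval_mult absval_p del: of_nat_Suc mult_Suc_right)
qed simp

text \<open>A weak form of Legendre's formula, v(n!) <= n/(p-1). With m = n div p one has |n!| =
  p^(-m) |m!|, and \<open>radius ^ (p - 1)\<close> is 1/p, so the bound for \<open>m\<close> gives
  the one for \<open>p * m\<close> and hence for \<open>n\<close>.\<close>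

lemma absval_fact_ge: "radius ^ n \<le> absval (fact n :: 'a)"
proof (induction n rule: less_induct)
  case (less n)
  define m where "m = n div p"
  have n: "n = p * m + n mod p" "n mod p < p" using p_gt_1 by (auto simp: m_def)
  have fact_n: "absval (fact n :: 'a) = (1 / real p) ^ m * absval (fact m :: 'a)"
    using absval_fact_p_mult_add[OF n(2), of m] absval_fact_p_mult[of m] n(1) by simp
  show ?case
  proof (cases "m = 0")
    case True
    with fact_n show ?thesis using power_le_one[of radius] radius(1,2) by simp
  next
    case False
    then have "m < n" using p_gt_1 by (cases n) (auto simp: m_def)
    have "radius ^ n \<le> radius ^ (p * m)"
      using n(1) radius(1,2) by (intro power_decreasing) linarith+
    also have "p * m = (p - 1) * m + m" using p_gt_1 by (cases p) auto
    also have "radius ^ ((p - 1) * m + m) = (radius ^ (p - 1)) ^ m * radius ^ m"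
      by (simp add: power_add power_mult)
    also have "\<dots> \<le> (1 / real p) ^ m * absval (fact m :: 'a)"
      using radius by (intro mult_mono power_mono less.IH \<open>m < n\<close>) auto
    finally show ?thesis by (simp add: fact_n)
  qed
qed

lemma power_over_fact_tendsto_0:
  fixes t :: 'a
  assumes t: "absval t < radius"
  shows "(\<lambda>n. absval (t ^ n / fact n)) \<longlonglongrightarrow> 0"
proof -
  have "absval (t ^ n / fact n) \<le> (absval t / radius) ^ n" for n
    using absval_fact_ge[of n] radius
    by (simp add: absval_divide absval_power power_divide frac_le)
  moreover have "(\<lambda>n. (absval t / radius) ^ n) \<longlonglongrightarrow> 0"
    using t radius by (intro LIMSEQ_realpow_zero) auto
  ultimately show ?thesis
    by (intro Lim_null_comparison[of "\<lambda>n. absval (t ^ n / fact n)"]) auto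
qed

section \<open>Powers with p-adic integer exponent\<close>

lemma absval_power_diff:
  fixes q :: 'a
  assumes "absval (1 - q) < radius"
  shows "absval (q ^ m - q ^ n) \<le> absval (1 - q) * absval (of_nat m - of_nat n :: 'a)"
proof -
  have q: "absval q = 1"
    using absval_eqI_dominant[of q 1] absval_minus_commute[of q 1] assms radius(2) by simp
  have *: "absval (q ^ m - q ^ n) = absval (1 - q) * absval (of_nat m - of_nat n :: 'a)"
    if "m \<le> n" for m n
  proof -
    \<comment> \<open>Factoring out the smaller power, a unit, reduces the difference to the
      estimate for a single power.\<close>
    have "q ^ m - q ^ n = q ^ m * (1 - q ^ (n - m))"
      using that by (simp add: right_diff_distrib flip: power_add)
    then show ?thesis
      using that absval_one_minus_power[OF assms, of "n - m"]
        absval_minus_commute[of "of_nat n :: 'a" "of_nat m"]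
      by (simp add: absval_mult absval_power q of_nat_diff)
  qed
  show ?thesis
    using *[of m n] *[of n m] absval_minus_commute[of "q ^ m" "q ^ n"]
      absval_minus_commute[of "of_nat m :: 'a" "of_nat n"]
    by (cases "m \<le> n") auto
qed

text \<open>\<open>padic_integers\<close> is a closure of all integers, whereas
  \<open>padic_power\<close> is a limit over natural exponents; this bridges the two.\<close>

lemma padic_integers_nat_approx:
  assumes "z \<in> (padic_integers :: 'a set)"
  obtains s :: "nat \<Rightarrow> nat" where "(\<lambda>n. of_nat (s n)) \<longlonglongrightarrow> z"
proof -
  obtain x where x: "\<And>n. x n \<in> \<int>" "x \<longlonglongrightarrow> z"
    using assms unfolding padic_integers_def closure_sequential by blast
  have "\<exists>k. x n = of_int k" for n
    using x(1)[of n] by (auto elim: Ints_cases)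
  then obtain k where k: "\<And>n. x n = of_int (k n)"
    using choice[of "\<lambda>n k. x n = of_int k"] by auto
  \<comment> \<open>Reducing modulo \<open>p ^ n\<close> makes the approximant nonnegative and moves
    it by at most |p^n|, which tends to 0.\<close>
  define s where "s n = nat (k n mod int (p ^ n))" for n
  have "(\<lambda>n. of_nat (s n) - x n) \<longlonglongrightarrow> 0"
  proof (rule tendsto_absvalI[OF absval_p_power_tendsto])
    fix n
    have "int (p ^ n) > 0" using p_gt_1 by simp
    then have "int (s n) = k n mod int (p ^ n)"
      unfolding s_def by (intro nat_0_le pos_mod_sign)
    then have "int (s n) = k n - int (p ^ n) * (k n div int (p ^ n))"
      by (simp only: minus_mult_div_eq_mod)
    from arg_cong[OF this, of "of_int :: int \<Rightarrow> 'a"]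
    have "of_nat (s n) = x n - of_nat (p ^ n) * (of_int (k n div int (p ^ n)) :: 'a)"
      by (simp only: k of_int_diff of_int_mult of_int_of_nat_eq)
    then have "absval (of_nat (s n) - x n - 0)
        = absval (of_nat (p ^ n) :: 'a) * absval (of_int (k n div int (p ^ n)) :: 'a)"
      by (simp only: absval_mult[symmetric] absval_minus diff_zero) simp
    also have "\<dots> \<le> absval (of_nat (p ^ n) :: 'a) * 1"
      by (intro mult_left_mono absval_of_int_le) auto
    finally show "absval (of_nat (s n) - x n - 0) \<le> absval (of_nat (p ^ n) :: 'a)" by simp
  qed
  from tendsto_add[OF this x(2)] have "(\<lambda>n. of_nat (s n)) \<longlonglongrightarrow> z"
    by (simp only: diff_add_cancel add_0)
  then show ?thesis by (rule that)
qed

text \<open>The map n to q^n is Lipschitz for the p-adic distance of exponents. This makes the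
  sequence of powers Cauchy and forces its limit to be the limit along the whole filter that defines
  \<open>padic_power\<close>.\<close>

lemma padic_power_LIMSEQ:
  fixes q :: 'a
  assumes q: "absval (1 - q) < radius" and s: "(\<lambda>k. of_nat (s k)) \<longlonglongrightarrow> z"
  shows "(\<lambda>k. q ^ s k) \<longlonglongrightarrow> padic_power q z"
proof -
  have le: "absval (q ^ m - q ^ n) \<le> absval (of_nat m - of_nat n :: 'a)" for m n
    using absval_power_diff[OF q, of m n] q radius(2)
      mult_right_mono[of "absval (1 - q)" 1 "absval (of_nat m - of_nat n :: 'a)"] by simp
  have "Cauchy (\<lambda>k. of_nat (s k) :: 'a)"
    using s by (intro convergent_Cauchy) (auto simp: convergent_def)
  then have "Cauchy (\<lambda>k. q ^ s k)"
    unfolding Cauchy_def dist_absval using le by (meson le_less_trans)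
  then obtain L where L: "(\<lambda>k. q ^ s k) \<longlonglongrightarrow> L"
    using Cauchy_convergent convergent_def by blast
  let ?F = "filtercomap of_nat (nhds z) :: nat filter"
  have "((\<lambda>n. q ^ n) \<longlongrightarrow> L) ?F"
  proof (rule tendsto_absvalI)
    show "((\<lambda>n. absval (of_nat n - z)) \<longlongrightarrow> 0) ?F"
      by (rule tendsto_absval_iff[THEN iffD1, OF filterlim_filtercomap])
    fix n
    have "(\<lambda>k. dist (q ^ n) (q ^ s k)) \<longlonglongrightarrow> dist (q ^ n) L"
      by (intro tendsto_dist tendsto_const L)
    moreover have "(\<lambda>k. dist (of_nat n :: 'a) (of_nat (s k))) \<longlonglongrightarrow> dist (of_nat n) z"
      by (intro tendsto_dist tendsto_const s)
    ultimately show "absval (q ^ n - L) \<le> absval (of_nat n - z)"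
      unfolding dist_absval using le by (blast intro: LIMSEQ_le)
  qed
  \<comment> \<open>\<open>Lim\<close> is determined only along a proper filter; the sequence
    \<open>s\<close> provides natural numbers in every neighbourhood of \<open>z\<close>.\<close>
  moreover have "?F \<noteq> bot"
  proof (rule filtercomap_neq_bot)
    fix P assume "eventually P (nhds z)"
    then have "\<forall>\<^sub>F k in sequentially. P (of_nat (s k))"
      using s by (simp add: filterlim_iff)
    then show "\<exists>n. P (of_nat n)" by (auto simp: eventually_sequentially)
  qed
  ultimately have "padic_power q z = L"
    unfolding padic_power_def by (intro tendsto_Lim)
  with L show ?thesis by simp
qed

lemma padic_power_of_nat:
  assumes "absval (1 - q :: 'a) < radius"
  shows "padic_power q (of_nat n) = q ^ n"
  using padic_power_LIMSEQ[OF assms, of "\<lambda>_. n"] by (simp add: LIMSEQ_const_iff)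

lemma padic_power_add_of_nat:
  assumes q: "absval (1 - q :: 'a) < radius" and "z \<in> padic_integers"
  shows "padic_power q (z + of_nat n) = padic_power q z * q ^ n"
proof -
  obtain s where s: "(\<lambda>k. of_nat (s k)) \<longlonglongrightarrow> z"
    using padic_integers_nat_approx[OF assms(2)] .
  have "(\<lambda>k. of_nat (s k + n)) \<longlonglongrightarrow> z + of_nat n"
    unfolding of_nat_add by (intro tendsto_add s tendsto_const)
  from padic_power_LIMSEQ[OF q this]
  have "(\<lambda>k. q ^ s k * q ^ n) \<longlonglongrightarrow> padic_power q (z + of_nat n)"
    by (simp add: power_add)
  moreover have "(\<lambda>k. q ^ s k * q ^ n) \<longlonglongrightarrow> padic_power q z * q ^ n"
    by (intro tendsto_mult padic_power_LIMSEQ[OF q s] tendsto_const)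
  ultimately show ?thesis by (rule LIMSEQ_unique)
qed

text \<open>The bound for natural exponents passes to the limit. It places [z]_q in the unit ball
  and makes the power of \<open>q\<close> a unit.\<close>

lemma absval_one_minus_padic_power:
  assumes q: "absval (1 - q :: 'a) < radius" and "z \<in> padic_integers"
  shows "absval (1 - padic_power q z) \<le> absval (1 - q)"
proof -
  obtain s where s: "(\<lambda>k. of_nat (s k)) \<longlonglongrightarrow> z"
    using padic_integers_nat_approx[OF assms(2)] .
  have "(\<lambda>k. 1 - q ^ s k) \<longlonglongrightarrow> 1 - padic_power q z"
    by (intro tendsto_diff padic_power_LIMSEQ[OF q s] tendsto_const)
  moreover have "absval (1 - q ^ s k) \<le> absval (1 - q)" for k
    using absval_one_minus_power[OF q, of "s k"] absval_of_nat_le[of "s k", where ?'a = 'a]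
    by (simp add: mult_left_le_one_le)
  ultimately show ?thesis by (rule absval_le_limit)
qed

lemma padic_integers_of_nat_mult:
  assumes "z \<in> (padic_integers :: 'a set)"
  shows "of_nat n * z \<in> padic_integers"
proof -
  obtain s where s: "(\<lambda>k. of_nat (s k)) \<longlonglongrightarrow> z"
    using padic_integers_nat_approx[OF assms] .
  have "(\<lambda>k. of_nat n * of_nat (s k)) \<longlonglongrightarrow> of_nat n * z"
    by (intro tendsto_mult s tendsto_const)
  then show ?thesis
    unfolding padic_integers_def closure_sequential
    by (intro exI[of _ "\<lambda>k. of_nat n * of_nat (s k)"]) (auto intro: Ints_mult)
qed

end

section \<open>Functions with bounded iterated difference quotients\<close>

definition shift_diff :: "nat \<Rightarrow> (nat \<Rightarrow> 'a::ab_group_add) \<Rightarrow> nat \<Rightarrow> 'a" where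
  "shift_diff h f m = f (m + h) - f m"

primrec iter_diff :: "nat list \<Rightarrow> (nat \<Rightarrow> 'a::ab_group_add) \<Rightarrow> nat \<Rightarrow> 'a" where
  "iter_diff [] f = f"
| "iter_diff (h # hs) f = iter_diff hs (shift_diff h f)"

text \<open>Integration costs one order of differences, so bounds of all orders are demanded to
  obtain a class stable under repeated integration. The empty list gives the bound on the
  values.\<close>

definition lip_bound :: "real \<Rightarrow> (nat \<Rightarrow> 'a::nonarch_complete_field) \<Rightarrow> bool" where
  "lip_bound B f \<longleftrightarrow>
     (\<forall>hs m. absval (iter_diff hs f m) \<le> B * (\<Prod>h\<leftarrow>hs. absval (of_nat h :: 'a)))"

lemma iter_diff_add: "iter_diff hs (\<lambda>m. f m + g m) = (\<lambda>m. iter_diff hs f m + iter_diff hs g m)"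
proof (induction hs arbitrary: f g)
  case (Cons h hs)
  have "shift_diff h (\<lambda>m. f m + g m) = (\<lambda>m. shift_diff h f m + shift_diff h g m)"
    by (auto simp: shift_diff_def)
  with Cons show ?case by simp
qed simp

lemma iter_diff_shift: "iter_diff hs (\<lambda>m. f (m + a)) = (\<lambda>m. iter_diff hs f (m + a))"
proof (induction hs arbitrary: f)
  case (Cons h hs)
  have "shift_diff h (\<lambda>m. f (m + a)) = (\<lambda>m. shift_diff h f (m + a))"
    by (auto simp: shift_diff_def ac_simps)
  with Cons show ?case by simp
qed simp

lemma iter_diff_tendsto:
  fixes f :: "nat \<Rightarrow> 'a::topological_ab_group_add"
  assumes "\<And>m. (\<lambda>k. g k m) \<longlonglongrightarrow> f m"
  shows "(\<lambda>k. iter_diff hs (g k) m) \<longlonglongrightarrow> iter_diff hs f m"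
  using assms
proof (induction hs arbitrary: f g m)
  case (Cons h hs)
  have "(\<lambda>k. shift_diff h (g k) m) \<longlonglongrightarrow> shift_diff h f m" for m
    unfolding shift_diff_def by (intro tendsto_diff Cons.prems)
  from Cons.IH[OF this] show ?case by simp
qed simp

lemma lip_boundD: "lip_bound B f \<Longrightarrow> absval (f m) \<le> B"
  unfolding lip_bound_def by (drule spec[of _ "[]"]) simp

lemma lip_bound_shift_diff:
  fixes f :: "nat \<Rightarrow> 'a::nonarch_complete_field"
  assumes "lip_bound B f"
  shows "lip_bound (B * absval (of_nat h :: 'a)) (shift_diff h f)"
  unfolding lip_bound_def
proof (intro allI)
  fix hs m
  show "absval (iter_diff hs (shift_diff h f) m)
      \<le> B * absval (of_nat h :: 'a) * (\<Prod>h\<leftarrow>hs. absval (of_nat h :: 'a))"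
    using assms[unfolded lip_bound_def, rule_format, of "h # hs" m] by (simp add: mult.assoc)
qed

lemma lip_boundI:
  fixes f :: "nat \<Rightarrow> 'a::nonarch_complete_field"
  assumes "\<And>m. absval (f m) \<le> B"
    and "\<And>h. lip_bound (B * absval (of_nat h :: 'a)) (shift_diff h f)"
  shows "lip_bound B f"
  unfolding lip_bound_def
proof (intro allI)
  fix hs m
  show "absval (iter_diff hs f m) \<le> B * (\<Prod>h\<leftarrow>hs. absval (of_nat h :: 'a))"
    using assms(1)[of m] assms(2)[unfolded lip_bound_def]
    by (cases hs) (auto simp: mult.assoc)
qed

lemma lip_bound_nonneg: "lip_bound B f \<Longrightarrow> 0 \<le> B"
  using lip_boundD[of B f 0] absval_nonneg[of "f 0"] by linarith

lemma prod_list_absval_nonneg: "0 \<le> (\<Prod>h\<leftarrow>hs. absval (f h))"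
  by (induction hs) auto

lemma lip_bound_mono:
  fixes f :: "nat \<Rightarrow> 'a::nonarch_complete_field"
  assumes "lip_bound B f" and "B \<le> C"
  shows "lip_bound C f"
  unfolding lip_bound_def
proof (intro allI)
  fix hs m
  show "absval (iter_diff hs f m) \<le> C * (\<Prod>h\<leftarrow>hs. absval (of_nat h :: 'a))"
    using assms(1)[unfolded lip_bound_def, rule_format, of hs m]
      mult_right_mono[OF assms(2) prod_list_absval_nonneg[of "of_nat :: nat \<Rightarrow> 'a" hs]]
    by linarith
qed

lemma lip_bound_add: "lip_bound B f \<Longrightarrow> lip_bound B g \<Longrightarrow> lip_bound B (\<lambda>m. f m + g m)"
  unfolding lip_bound_def iter_diff_add by (auto intro: absval_add_le)

lemma lip_bound_shift: "lip_bound B f \<Longrightarrow> lip_bound B (\<lambda>m. f (m + a))"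
  unfolding lip_bound_def iter_diff_shift by auto

text \<open>An iterated difference at \<open>m\<close> involves only finitely many values, so
  pointwise convergence suffices.\<close>

lemma lip_bound_limit:
  assumes "\<And>m. (\<lambda>k. g k m) \<longlonglongrightarrow> f m" and "\<And>k. lip_bound B (g k)"
  shows "lip_bound B f"
  unfolding lip_bound_def
proof (intro allI)
  fix hs m
  show "absval (iter_diff hs f m) \<le> B * (\<Prod>h\<leftarrow>hs. absval (of_nat h :: 'a))"
    using assms(2)[unfolded lip_bound_def]
    by (intro absval_le_limit[OF iter_diff_tendsto[OF assms(1)]]) auto
qed

text \<open>By the Leibniz rule each summand of the difference of a product has one differenced
  factor, whose bound absorbs |h|. The strong triangle inequality keeps the two summands from
  doubling the bound; since the factors' bounds change, the induction is over all \<open>B\<close>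
  and \<open>C\<close>.\<close>

lemma lip_bound_mult:
  fixes f g :: "nat \<Rightarrow> 'a::nonarch_complete_field"
  assumes "lip_bound B f" and "lip_bound C g"
  shows "lip_bound (B * C) (\<lambda>m. f m * g m)"
proof -
  have "absval (iter_diff hs (\<lambda>m. f m * g m) m)
      \<le> B * C * (\<Prod>h\<leftarrow>hs. absval (of_nat h :: 'a))" for hs m
    using assms
  proof (induction hs arbitrary: f g B C m)
    case Nil
    then show ?case
      using lip_bound_nonneg[of B f] by (auto simp: absval_mult intro!: mult_mono lip_boundD)
  next
    case (Cons h hs)
    have eq: "shift_diff h (\<lambda>m. f m * g m)
        = (\<lambda>m. shift_diff h f m * g (m + h) + f m * shift_diff h g m)"
      by (auto simp: shift_diff_def algebra_simps)
    have "absval (iter_diff hs (\<lambda>m. shift_diff h f m * g (m + h)) m)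
        \<le> B * absval (of_nat h :: 'a) * C * (\<Prod>h\<leftarrow>hs. absval (of_nat h :: 'a))"
      by (intro Cons.IH lip_bound_shift_diff lip_bound_shift Cons.prems)
    moreover have "absval (iter_diff hs (\<lambda>m. f m * shift_diff h g m) m)
        \<le> B * (C * absval (of_nat h :: 'a)) * (\<Prod>h\<leftarrow>hs. absval (of_nat h :: 'a))"
      by (intro Cons.IH lip_bound_shift_diff Cons.prems)
    ultimately show ?case
      by (simp add: eq iter_diff_add absval_add_le ac_simps)
  qed
  then show ?thesis unfolding lip_bound_def by blast
qed

lemma lip_bound_0: "0 \<le> B \<Longrightarrow> lip_bound B (\<lambda>_. 0)"
proof -
  have "iter_diff hs (\<lambda>_. 0) m = (0 :: 'a::nonarch_complete_field)" for hs m
    by (induction hs) (auto simp: shift_diff_def[abs_def])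
  then show "0 \<le> B \<Longrightarrow> ?thesis"
    unfolding lip_bound_def by (simp add: prod_list_absval_nonneg)
qed

lemma lip_bound_const: "lip_bound (absval c) (\<lambda>_. c)"
  by (rule lip_boundI) (auto simp: shift_diff_def[abs_def] intro!: lip_bound_0)

lemma lip_bound_cmult: "lip_bound B f \<Longrightarrow> lip_bound (absval c * B) (\<lambda>m. c * f m)"
  by (rule lip_bound_mult[OF lip_bound_const])

lemma lip_bound_diff:
  assumes "lip_bound B f" and "lip_bound B g"
  shows "lip_bound B (\<lambda>m. f m - g m)"
proof -
  have "lip_bound B (\<lambda>m. - g m)"
    using lip_bound_cmult[OF assms(2), of "- 1"] by simp
  from lip_bound_add[OF assms(1) this] show ?thesis by simp
qed

lemma lip_bound_sum:
  assumes "\<And>i. i \<in> A \<Longrightarrow> lip_bound B (f i)" and "0 \<le> B"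
  shows "lip_bound B (\<lambda>m. \<Sum>i\<in>A. f i m)"
  using assms(1)
  by (induction A rule: infinite_finite_induct) (auto intro: lip_bound_add lip_bound_0 assms(2))

lemma lip_bound_prod:
  fixes f :: "'i \<Rightarrow> nat \<Rightarrow> 'a::nonarch_complete_field"
  assumes "\<And>i. i \<in> A \<Longrightarrow> lip_bound 1 (f i)"
  shows "lip_bound 1 (\<lambda>m. \<Prod>i\<in>A. f i m)"
proof -
  have 1: "lip_bound 1 (\<lambda>_. 1 :: 'a)"
    using lip_bound_const[of 1] by simp
  show ?thesis
    using assms
  proof (induction A rule: infinite_finite_induct)
    case (insert i A)
    then show ?case using lip_bound_mult[of 1 "f i" 1] by simp
  qed (simp_all add: 1)
qed

section \<open>Exponential polynomials and their closure\<close>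

text \<open>These are the polynomials in \<open>q ^ m\<close>; the zero function is the monomial
  with \<open>c = 0\<close>.\<close>

inductive exp_poly :: "'a::field \<Rightarrow> (nat \<Rightarrow> 'a) \<Rightarrow> bool" for q where
  monomial: "exp_poly q (\<lambda>m. c * q ^ (k * m))"
| add: "exp_poly q f \<Longrightarrow> exp_poly q g \<Longrightarrow> exp_poly q (\<lambda>m. f m + g m)"

lemma exp_poly_const: "exp_poly q (\<lambda>_. c)"
  using exp_poly.monomial[of q c 0] by simp

lemma exp_poly_cmult: "exp_poly q f \<Longrightarrow> exp_poly q (\<lambda>m. c * f m)"
proof (induction rule: exp_poly.induct)
  case (monomial a k)
  show ?case using exp_poly.monomial[of q "c * a" k] by (simp add: mult.assoc)
qed (simp add: distrib_left exp_poly.add)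

lemma exp_poly_shift: "exp_poly q f \<Longrightarrow> exp_poly q (\<lambda>m. f (m + a))"
proof (induction rule: exp_poly.induct)
  case (monomial c k)
  show ?case
    using exp_poly.monomial[of q "c * q ^ (k * a)" k]
    by (simp add: power_add distrib_left mult_ac)
qed (rule exp_poly.add)

lemma exp_poly_mult: "exp_poly q f \<Longrightarrow> exp_poly q g \<Longrightarrow> exp_poly q (\<lambda>m. f m * g m)"
proof (induction rule: exp_poly.induct)
  case (monomial c k)
  from monomial show ?case
  proof (induction rule: exp_poly.induct)
    case (monomial d l)
    show ?case
      using exp_poly.monomial[of q "c * d" "k + l"]
      by (simp add: power_add distrib_right distrib_left mult_ac)
  qed (simp add: distrib_left exp_poly.add)
qed (simp add: distrib_right exp_poly.add)

lemma exp_poly_sum: "(\<And>i. i \<in> A \<Longrightarrow> exp_poly q (f i)) \<Longrightarrow> exp_poly q (\<lambda>m. \<Sum>i\<in>A. f i m)"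
  by (induction A rule: infinite_finite_induct) (auto intro: exp_poly_const exp_poly.add)

lemma exp_poly_prod: "(\<And>i. i \<in> A \<Longrightarrow> exp_poly q (f i)) \<Longrightarrow> exp_poly q (\<lambda>m. \<Prod>i\<in>A. f i m)"
  by (induction A rule: infinite_finite_induct) (auto intro: exp_poly_const exp_poly_mult)

text \<open>Closeness is measured by \<open>lip_bound\<close> rather than by the supremum, because
  the division by p^N in Riemann sums is controlled through differences.\<close>

definition approximable :: "'a::nonarch_complete_field \<Rightarrow> (nat \<Rightarrow> 'a) \<Rightarrow> bool" where
  "approximable q f \<longleftrightarrow> (\<forall>\<epsilon>>0. \<exists>e. exp_poly q e \<and> lip_bound \<epsilon> (\<lambda>m. f m - e m))"

lemma approximable_exp_poly: "exp_poly q f \<Longrightarrow> approximable q f"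
  unfolding approximable_def by (auto intro!: exI[of _ f] lip_bound_0)

lemma approximable_add:
  assumes "approximable q f" and "approximable q g"
  shows "approximable q (\<lambda>m. f m + g m)"
  unfolding approximable_def
proof (intro allI impI)
  fix \<epsilon> :: real assume "\<epsilon> > 0"
  then obtain d e where "exp_poly q d" "lip_bound \<epsilon> (\<lambda>m. f m - d m)"
    "exp_poly q e" "lip_bound \<epsilon> (\<lambda>m. g m - e m)"
    using assms unfolding approximable_def by meson
  then show "\<exists>e. exp_poly q e \<and> lip_bound \<epsilon> (\<lambda>m. f m + g m - e m)"
    using lip_bound_add[of \<epsilon> "\<lambda>m. f m - d m" "\<lambda>m. g m - e m"]
    by (intro exI[of _ "\<lambda>m. d m + e m"]) (simp add: exp_poly.add add_diff_add)
qed

lemma approximable_cmult: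
  assumes "approximable q f"
  shows "approximable q (\<lambda>m. c * f m)"
  unfolding approximable_def
proof (intro allI impI)
  fix \<epsilon> :: real assume "\<epsilon> > 0"
  \<comment> \<open>The added 1 keeps the denominator positive when \<open>c = 0\<close>.\<close>
  define \<delta> where "\<delta> = \<epsilon> / (absval c + 1)"
  have c: "absval c + 1 > 0" using absval_nonneg[of c] by linarith
  with \<open>\<epsilon> > 0\<close> have "\<delta> > 0" by (simp add: \<delta>_def)
  then obtain e where e: "exp_poly q e" "lip_bound \<delta> (\<lambda>m. f m - e m)"
    using assms unfolding approximable_def by meson
  have "absval c * \<delta> \<le> \<epsilon>"
    using c \<open>\<epsilon> > 0\<close> by (simp add: \<delta>_def field_simps)
  from lip_bound_mono[OF lip_bound_cmult[OF e(2)] this]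
  have "lip_bound \<epsilon> (\<lambda>m. c * f m - c * e m)" by (simp add: right_diff_distrib)
  with exp_poly_cmult[OF e(1)]
  show "\<exists>e. exp_poly q e \<and> lip_bound \<epsilon> (\<lambda>m. c * f m - e m)" by blast
qed

lemma approximable_shift:
  assumes "approximable q f"
  shows "approximable q (\<lambda>m. f (m + a))"
  unfolding approximable_def
proof (intro allI impI)
  fix \<epsilon> :: real assume "\<epsilon> > 0"
  then obtain e where e: "exp_poly q e" "lip_bound \<epsilon> (\<lambda>m. f m - e m)"
    using assms unfolding approximable_def by meson
  from exp_poly_shift[OF e(1)] lip_bound_shift[OF e(2), of a]
  show "\<exists>e. exp_poly q e \<and> lip_bound \<epsilon> (\<lambda>m. f (m + a) - e m)" by blast
qed

lemma approximable_diff: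
  assumes "approximable q f" and "approximable q g"
  shows "approximable q (\<lambda>m. f m - g m)"
  using approximable_add[OF assms(1) approximable_cmult[OF assms(2), of "- 1"]] by simp

lemma approximable_shift_diff: "approximable q f \<Longrightarrow> approximable q (shift_diff h f)"
  unfolding shift_diff_def[abs_def] by (intro approximable_diff approximable_shift)

lemma approximable_sum:
  "(\<And>i. i \<in> A \<Longrightarrow> approximable q (f i)) \<Longrightarrow> approximable q (\<lambda>m. \<Sum>i\<in>A. f i m)"
  by (induction A rule: infinite_finite_induct)
    (auto intro: approximable_exp_poly exp_poly_const approximable_add)

section \<open>The \<open>q\<close>-integral as an operator\<close>

locale padic_q = padic_base p ty
  for p :: nat and ty :: "'a::nonarch_complete_field itself" +
  fixes q :: 'a
  assumes q_ne_1: "q \<noteq> 1" and q_ball: "absval (1 - q) < radius"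
begin

lemma absval_q: "absval q = 1"
  using absval_eqI_dominant[of q 1] absval_minus_commute[of q 1] q_ball radius(2) by simp

lemma q_power_eq_1_iff: "q ^ n = 1 \<longleftrightarrow> n = 0"
  using absval_one_minus_power[OF q_ball, of n] q_ne_1
  by (metis absval_eq_0_iff mult_eq_0_iff of_nat_eq_0_iff power_0 right_minus_eq)

lemma q_power_ball: "absval (1 - q ^ n) < radius"
proof -
  have "absval (1 - q ^ n) \<le> 1 * absval (1 - q)"
    unfolding absval_one_minus_power[OF q_ball]
    by (intro mult_right_mono absval_of_nat_le) auto
  with q_ball show ?thesis by simp
qed

text \<open>Powers of \<open>q\<close> are eigenfunctions of every difference operator, with
  eigenvalue \<open>q ^ h - 1\<close> of absolute value at most |h|.\<close>

lemma lip_bound_q_power: "lip_bound 1 (\<lambda>m. q ^ m)"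
  unfolding lip_bound_def
proof (intro allI)
  fix hs m
  \<comment> \<open>The scalar \<open>c\<close> collects the eigenvalues during the
    induction.\<close>
  have eq: "iter_diff hs (\<lambda>m. c * q ^ m) m = c * q ^ m * (\<Prod>h\<leftarrow>hs. q ^ h - 1)" for c
  proof (induction hs arbitrary: c)
    case (Cons h hs)
    have "shift_diff h (\<lambda>m. c * q ^ m) = (\<lambda>m. (c * (q ^ h - 1)) * q ^ m)"
      by (auto simp: shift_diff_def power_add algebra_simps)
    then show ?case using Cons[of "c * (q ^ h - 1)"] by (simp add: mult_ac)
  qed simp
  have "absval (\<Prod>h\<leftarrow>hs. q ^ h - 1) \<le> (\<Prod>h\<leftarrow>hs. absval (of_nat h :: 'a))"
  proof (induction hs)
    case (Cons h hs)
    have "absval (q ^ h - 1) \<le> absval (of_nat h :: 'a) * 1"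
      unfolding absval_minus_commute[of "q ^ h"] absval_one_minus_power[OF q_ball]
      using q_ball radius(2) by (intro mult_left_mono) auto
    then show ?case
      using Cons by (auto simp: absval_mult intro!: mult_mono)
  qed simp
  then show "absval (iter_diff hs ((^) q) m) \<le> 1 * (\<Prod>h\<leftarrow>hs. absval (of_nat h :: 'a))"
    using eq[of 1] by (simp add: absval_mult absval_power absval_q)
qed

text \<open>Cut the range into \<open>p\<close> blocks of length \<open>p ^ N\<close>. Replacing
  every block by the first one costs at most B |p^N| per term; what is left is \<open>p\<close>
  times the previous sum. Both parts meet the bound, since p |p^(N+1)| = |p^N|.\<close>

lemma absval_sum_p_power_le:
  fixes g :: "nat \<Rightarrow> 'a"
  assumes "\<And>y. absval (g y) \<le> B"
    and "\<And>y h. absval (g (y + h) - g y) \<le> B * absval (of_nat h :: 'a)"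
  shows "absval (\<Sum>y<p ^ N. g y) \<le> real p * B * absval (of_nat (p ^ N) :: 'a)"
proof (induction N)
  case 0
  have "0 \<le> B" using assms(1)[of 0] absval_nonneg[of "g 0"] by linarith
  then have "B \<le> real p * B"
    using p_gt_1 by (simp add: mult_le_cancel_right1)
  then show ?case using assms(1)[of 0] by simp
next
  case (Suc N)
  have "0 \<le> B" using assms(1)[of 0] absval_nonneg[of "g 0"] by linarith
  have "(\<Sum>y<p ^ Suc N. g y) = (\<Sum>i<p. \<Sum>y<p ^ N. g (y + i * p ^ N))"
    using sum.nat_group[of g "p ^ N" p]
      sum.shift_bounds_nat_ivl[of g 0 "i * p ^ N" "p ^ N" for i, symmetric]
    by (simp add: lessThan_atLeast0 add.commute)
  also have "\<dots> = (\<Sum>i<p. \<Sum>y<p ^ N. g (y + i * p ^ N) - g y) + of_nat p * (\<Sum>y<p ^ N. g y)"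
    by (simp add: sum_subtractf)
  also have "absval \<dots> \<le> B * absval (of_nat (p ^ N) :: 'a)"
  proof (rule absval_add_le)
    have "absval (g (y + i * p ^ N) - g y) \<le> B * absval (of_nat (p ^ N) :: 'a)" for y i
    proof -
      have "absval (of_nat (i * p ^ N) :: 'a) \<le> 1 * absval (of_nat (p ^ N) :: 'a)"
        unfolding of_nat_mult absval_mult by (intro mult_right_mono absval_of_nat_le) auto
      with \<open>0 \<le> B\<close> show ?thesis
        by (intro order_trans[OF assms(2)] mult_left_mono) auto
    qed
    then show "absval (\<Sum>i<p. \<Sum>y<p ^ N. g (y + i * p ^ N) - g y)
        \<le> B * absval (of_nat (p ^ N) :: 'a)"
      using \<open>0 \<le> B\<close> by (intro absval_sum_le) auto
    show "absval (of_nat p * (\<Sum>y<p ^ N. g y)) \<le> B * absval (of_nat (p ^ N) :: 'a)"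
      using Suc p_gt_1 by (simp add: absval_mult absval_p field_simps)
  qed
  also have "\<dots> = real p * B * absval (of_nat (p ^ Suc N) :: 'a)"
    using p_gt_1 by (simp add: absval_mult absval_p)
  finally show ?case .
qed

text \<open>\<open>q_integral w f m\<close> is the integral of \<open>y \<mapsto> f (m + w y)\<close> with
  respect to \<open>\<mu>\<close> of parameter \<open>q\<^sup>w\<close>.\<close>

definition riemann_sum :: "nat \<Rightarrow> (nat \<Rightarrow> 'a) \<Rightarrow> nat \<Rightarrow> nat \<Rightarrow> 'a" where
  "riemann_sum w f m N =
     (1 - q ^ w) / (1 - q ^ (w * p ^ N)) * (\<Sum>y<p ^ N. f (m + w * y) * q ^ (w * y))"

definition q_integral :: "nat \<Rightarrow> (nat \<Rightarrow> 'a) \<Rightarrow> nat \<Rightarrow> 'a" where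
  "q_integral w f m = lim (riemann_sum w f m)"

lemma riemann_sum_add:
  "riemann_sum w (\<lambda>m. f m + g m) m N = riemann_sum w f m N + riemann_sum w g m N"
  by (simp add: riemann_sum_def distrib_right distrib_left sum.distrib)

lemma riemann_sum_cmult: "riemann_sum w (\<lambda>m. c * f m) m N = c * riemann_sum w f m N"
  by (simp add: riemann_sum_def mult_ac sum_distrib_left)

lemma riemann_sum_diff:
  "riemann_sum w (\<lambda>m. f m - g m) m N = riemann_sum w f m N - riemann_sum w g m N"
  using riemann_sum_add[of w f "\<lambda>m. - 1 * g m" m N] riemann_sum_cmult[of w "- 1" g m N] by simp

text \<open>The normalising factor has absolute value exactly 1/|p^N|, as |w| and |1 - q| cancel,
  and the block estimate supplies the matching |p^N|. The bound is thus uniform in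
  \<open>N\<close>.\<close>

lemma riemann_sum_le:
  assumes "lip_bound B f" and "w \<ge> 1"
  shows "absval (riemann_sum w f m N) \<le> real p * B"
proof -
  define g where "g y = f (m + w * y) * q ^ (w * y)" for y
  have prod: "lip_bound B (\<lambda>y. f (m + y) * q ^ y)"
    using lip_bound_mult[OF lip_bound_shift[OF assms(1), of m] lip_bound_q_power]
    by (simp add: add.commute)
  have "absval (g y) \<le> B" for y
    unfolding g_def using lip_boundD[OF prod] by blast
  moreover have "absval (g (y + h) - g y) \<le> B * absval (of_nat h :: 'a)" for y h
  proof -
    \<comment> \<open>\<open>g\<close> samples y to f(m + y) q^y at multiples of \<open>w\<close>,
      so a step \<open>h\<close> becomes \<open>w * h\<close>.\<close>
    have "absval (g (y + h) - g y) \<le> B * absval (of_nat (w * h) :: 'a)"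
      using lip_boundD[OF lip_bound_shift_diff[OF prod, of "w * h"], of "w * y"]
      by (simp add: g_def shift_diff_def distrib_left add.assoc)
    also have "\<dots> \<le> B * (1 * absval (of_nat h :: 'a))"
      unfolding of_nat_mult absval_mult
      using lip_bound_nonneg[OF assms(1)]
      by (intro mult_left_mono mult_right_mono absval_of_nat_le) auto
    finally show ?thesis by simp
  qed
  ultimately have sum: "absval (\<Sum>y<p ^ N. g y) \<le> real p * B * absval (of_nat (p ^ N) :: 'a)"
    by (rule absval_sum_p_power_le)
  have "absval ((1 - q ^ w) / (1 - q ^ (w * p ^ N))) = 1 / absval (of_nat (p ^ N) :: 'a)"
    using assms(2) q_ne_1 by (simp add: absval_divide absval_one_minus_power[OF q_ball] absval_mult)
  then have "absval (riemann_sum w f m N)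
      = absval (\<Sum>y<p ^ N. g y) / absval (of_nat (p ^ N) :: 'a)"
    unfolding riemann_sum_def absval_mult by (simp add: g_def)
  also have "\<dots> \<le> real p * B"
    using sum p_gt_1 by (simp add: divide_le_eq)
  finally show ?thesis .
qed

text \<open>The sum is geometric. With Q = q^(w p^N), its numerator 1 - Q^(k+1) divided by the
  normalising 1 - Q leaves k + 1 powers of Q, each tending to 1.\<close>

lemma riemann_sum_monomial:
  assumes "w \<ge> 1"
  shows "riemann_sum w (\<lambda>m. q ^ (k * m)) m
           \<longlonglongrightarrow> of_nat (Suc k) * (1 - q ^ w) / (1 - q ^ (w * Suc k)) * q ^ (k * m)"
proof -
  \<comment> \<open>All factors independent of \<open>N\<close>.\<close>
  define c where "c = (1 - q ^ w) / (1 - q ^ (w * Suc k)) * q ^ (k * m)"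
  have nz: "1 - q ^ (w * Suc k) \<noteq> 0" "1 - q ^ (w * p ^ N) \<noteq> 0" for N
    using assms p_gt_1 q_power_eq_1_iff by (metis mult_eq_0_iff Suc_neq_Zero not_one_le_zero
        right_minus_eq, metis mult_eq_0_iff not_one_le_zero power_eq_0_iff not_less_zero right_minus_eq)
  have eq: "riemann_sum w (\<lambda>m. q ^ (k * m)) m N = c * (\<Sum>i\<le>k. (q ^ (w * p ^ N)) ^ i)" for N
  proof -
    have "(\<Sum>y<p ^ N. q ^ (k * (m + w * y)) * q ^ (w * y))
        = q ^ (k * m) * (\<Sum>y<p ^ N. (q ^ (w * Suc k)) ^ y)"
      unfolding sum_distrib_left
      by (intro sum.cong refl) (simp add: algebra_simps flip: power_mult power_add)
    also have "(1 - q ^ (w * Suc k)) * (\<Sum>y<p ^ N. (q ^ (w * Suc k)) ^ y)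
        = 1 - (q ^ (w * p ^ N)) ^ Suc k"
      using one_diff_power_eq[of "q ^ (w * Suc k)" "p ^ N"]
      by (simp only: power_mult[symmetric] ac_simps)
    then have "(\<Sum>y<p ^ N. (q ^ (w * Suc k)) ^ y)
        = (1 - (q ^ (w * p ^ N)) ^ Suc k) / (1 - q ^ (w * Suc k))"
      using nz(1) by (metis nonzero_mult_div_cancel_left)
    also have "1 - (q ^ (w * p ^ N)) ^ Suc k
        = (1 - q ^ (w * p ^ N)) * (\<Sum>i\<le>k. (q ^ (w * p ^ N)) ^ i)"
      by (simp only: one_diff_power_eq lessThan_Suc_atMost)
    finally show ?thesis
      using nz unfolding riemann_sum_def c_def by simp
  qed
  have one: "(\<lambda>N. (q ^ (w * p ^ N)) ^ i) \<longlonglongrightarrow> 1" for i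
  proof (rule tendsto_absvalI[OF absval_p_power_tendsto])
    fix N
    have "absval ((q ^ (w * p ^ N)) ^ i - 1) = absval (of_nat (w * p ^ N * i) :: 'a) * absval (1 - q)"
      using absval_one_minus_power[OF q_ball, of "w * p ^ N * i"]
        absval_minus_commute[of "q ^ (w * p ^ N * i)" 1]
      by (simp add: power_mult)
    also have "\<dots> = absval (of_nat (p ^ N) :: 'a) * (absval (of_nat (w * i) :: 'a) * absval (1 - q))"
      by (simp add: absval_mult)
    also have "\<dots> \<le> absval (of_nat (p ^ N) :: 'a) * (1 * 1)"
      using q_ball radius(2) by (intro mult_left_mono mult_mono absval_of_nat_le) auto
    finally show "absval ((q ^ (w * p ^ N)) ^ i - 1) \<le> absval (of_nat (p ^ N) :: 'a)" by simp
  qed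
  have "(\<lambda>N. c * (\<Sum>i\<le>k. (q ^ (w * p ^ N)) ^ i)) \<longlonglongrightarrow> c * (\<Sum>i\<le>k. 1)"
    by (intro tendsto_mult tendsto_const tendsto_sum one)
  moreover have "c * (\<Sum>i\<le>k. 1)
      = of_nat (Suc k) * (1 - q ^ w) / (1 - q ^ (w * Suc k)) * q ^ (k * m)"
    by (simp add: c_def mult_ac)
  ultimately show ?thesis
    unfolding eq[abs_def] by (simp only:)
qed

lemma riemann_sum_convergent_exp_poly:
  assumes "exp_poly q f" and "w \<ge> 1"
  shows "convergent (riemann_sum w f m)"
  using assms(1)
proof (induction rule: exp_poly.induct)
  case (monomial c k)
  show ?case
    using tendsto_mult[OF tendsto_const[of c] riemann_sum_monomial[OF assms(2), of k m]]
    unfolding convergent_def riemann_sum_cmult[abs_def] by blast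
next
  case (add f g)
  then show ?case
    unfolding convergent_def riemann_sum_add[abs_def] by (blast intro: tendsto_add)
qed

lemma q_integral_LIMSEQ:
  assumes "approximable q f" and w: "w \<ge> 1"
  shows "riemann_sum w f m \<longlonglongrightarrow> q_integral w f m"
proof -
  have "Cauchy (riemann_sum w f m)"
  proof (rule metric_CauchyI)
    fix \<epsilon> :: real assume "\<epsilon> > 0"
    \<comment> \<open>The Riemann sums of the error are bounded by \<open>real p * \<delta>\<close>,
      that is \<epsilon>/2, for all \<open>N\<close> at once; so the Cauchy property is inherited
      from the approximant.\<close>
    define \<delta> where "\<delta> = \<epsilon> / (2 * real p)"
    have "\<delta> > 0" using \<open>\<epsilon> > 0\<close> p_gt_1 by (simp add: \<delta>_def)
    then obtain e where e: "exp_poly q e" "lip_bound \<delta> (\<lambda>m. f m - e m)"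
      using assms unfolding approximable_def by meson
    have small: "absval (riemann_sum w f m N - riemann_sum w e m N) \<le> \<epsilon> / 2" for N
      using riemann_sum_le[OF e(2) w, of m N] p_gt_1 by (simp add: riemann_sum_diff \<delta>_def)
    have "Cauchy (riemann_sum w e m)"
      by (rule convergent_Cauchy[OF riemann_sum_convergent_exp_poly[OF e(1) w]])
    then obtain M where M: "\<And>i j. i \<ge> M \<Longrightarrow> j \<ge> M \<Longrightarrow>
        absval (riemann_sum w e m i - riemann_sum w e m j) < \<epsilon> / 2"
      using metric_CauchyD[of "riemann_sum w e m" "\<epsilon> / 2"] \<open>\<epsilon> > 0\<close> by (auto simp: dist_absval)
    have "dist (riemann_sum w f m i) (riemann_sum w f m j) < \<epsilon>" if "i \<ge> M" "j \<ge> M" for i j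
    proof -
      have "riemann_sum w f m i - riemann_sum w f m j
          = ((riemann_sum w f m i - riemann_sum w e m i) - (riemann_sum w f m j - riemann_sum w e m j))
            + (riemann_sum w e m i - riemann_sum w e m j)" by simp
      also have "absval \<dots> \<le> \<epsilon> / 2"
        using M[OF that] absval_diff_le[OF small small, of i j]
        by (intro absval_add_le) auto
      finally show ?thesis using \<open>\<epsilon> > 0\<close> by (simp add: dist_absval)
    qed
    then show "\<exists>M. \<forall>i\<ge>M. \<forall>j\<ge>M. dist (riemann_sum w f m i) (riemann_sum w f m j) < \<epsilon>"
      by blast
  qed
  then show ?thesis
    unfolding q_integral_def by (simp add: Cauchy_convergent flip: convergent_LIMSEQ_iff)
qed

section \<open>Linearity and translation of the integral\<close>

lemma q_integral_eqI: "riemann_sum w f m \<longlonglongrightarrow> L \<Longrightarrow> q_integral w f m = L"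
  unfolding q_integral_def by (rule limI)

lemma q_integral_add:
  assumes "approximable q f" "approximable q g" "w \<ge> 1"
  shows "q_integral w (\<lambda>m. f m + g m) m = q_integral w f m + q_integral w g m"
  using tendsto_add[OF q_integral_LIMSEQ[OF assms(1,3)] q_integral_LIMSEQ[OF assms(2,3)]]
  by (intro q_integral_eqI) (simp add: riemann_sum_add[abs_def])

lemma q_integral_cmult:
  assumes "approximable q f" "w \<ge> 1"
  shows "q_integral w (\<lambda>m. c * f m) m = c * q_integral w f m"
  using tendsto_mult[OF tendsto_const q_integral_LIMSEQ[OF assms]]
  by (intro q_integral_eqI) (simp add: riemann_sum_cmult[abs_def])

lemma q_integral_diff:
  assumes "approximable q f" "approximable q g" "w \<ge> 1"
  shows "q_integral w (\<lambda>m. f m - g m) m = q_integral w f m - q_integral w g m"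
  using tendsto_diff[OF q_integral_LIMSEQ[OF assms(1,3)] q_integral_LIMSEQ[OF assms(2,3)]]
  by (intro q_integral_eqI) (simp add: riemann_sum_diff[abs_def])

lemma q_integral_sum:
  assumes "\<And>i. i \<in> A \<Longrightarrow> approximable q (f i)" "w \<ge> 1"
  shows "q_integral w (\<lambda>m. \<Sum>i\<in>A. f i m) m = (\<Sum>i\<in>A. q_integral w (f i) m)"
proof -
  have 0: "q_integral w (\<lambda>m. 0) m = 0"
    by (intro q_integral_eqI) (simp add: riemann_sum_def[abs_def])
  show ?thesis
    using assms(1)
  proof (induction A rule: infinite_finite_induct)
    case (insert i A)
    then have "approximable q (f i)" "approximable q (\<lambda>m. \<Sum>i\<in>A. f i m)"
      by (auto intro: approximable_sum)
    then show ?case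
      using insert by (simp add: q_integral_add[OF _ _ assms(2)])
  qed (simp_all add: 0)
qed

lemma q_integral_shift: "q_integral w (\<lambda>m. f (m + a)) m = q_integral w f (m + a)"
  unfolding q_integral_def riemann_sum_def[abs_def] by (simp add: ac_simps)

lemma q_integral_monomial:
  assumes "w \<ge> 1"
  shows "q_integral w (\<lambda>m. c * q ^ (k * m)) m
    = c * (of_nat (Suc k) * (1 - q ^ w) / (1 - q ^ (w * Suc k)) * q ^ (k * m))"
  using tendsto_mult[OF tendsto_const[of c] riemann_sum_monomial[OF assms, of k m]]
  by (intro q_integral_eqI) (simp only: riemann_sum_cmult[abs_def])

section \<open>Stability of approximable functions under the integral\<close>

lemma exp_poly_q_integral:
  assumes "exp_poly q f" and w: "w \<ge> 1"
  shows "exp_poly q (q_integral w f)"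
  using assms(1)
proof (induction rule: exp_poly.induct)
  case (monomial c k)
  have "q_integral w (\<lambda>m. c * q ^ (k * m))
    = (\<lambda>m. (c * (of_nat (Suc k) * (1 - q ^ w) / (1 - q ^ (w * Suc k)))) * q ^ (k * m))"
    unfolding q_integral_monomial[OF w, abs_def] by (simp only: mult.assoc)
  then show ?case by (simp only: exp_poly.monomial)
next
  case (add f g)
  have "q_integral w (\<lambda>m. f m + g m) = (\<lambda>m. q_integral w f m + q_integral w g m)"
    using add by (intro ext q_integral_add w approximable_exp_poly)
  with add show ?case by (simp add: exp_poly.add)
qed

lemma q_integral_le:
  assumes "lip_bound B f" "approximable q f" "w \<ge> 1"
  shows "absval (q_integral w f m) \<le> real p * B"
  by (rule absval_le_limit[OF q_integral_LIMSEQ riemann_sum_le]) (fact assms)+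

text \<open>By linearity and translation the integral commutes with differences. They are moved onto
  \<open>f\<close> one by one, each multiplying its bound by |h|, until only the estimate of values
  is needed.\<close>

lemma lip_bound_q_integral:
  assumes "lip_bound B f" "approximable q f" and w: "w \<ge> 1"
  shows "lip_bound (real p * B) (q_integral w f)"
proof -
  have "absval (iter_diff hs (q_integral w f) m)
      \<le> real p * (B * (\<Prod>h\<leftarrow>hs. absval (of_nat h :: 'a)))" for hs m
    using assms(1,2)
  proof (induction hs arbitrary: f B)
    case Nil
    then show ?case using q_integral_le w by simp
  next
    case (Cons h hs)
    have "shift_diff h (q_integral w f) = q_integral w (shift_diff h f)"
      unfolding shift_diff_def[abs_def] using Cons.prems(2)
      by (intro ext) (simp add: q_integral_diff[OF _ _ w] approximable_shift q_integral_shift)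
    then show ?case
      using Cons.IH[OF lip_bound_shift_diff[OF Cons.prems(1)]
          approximable_shift_diff[OF Cons.prems(2)], of h]
      by (simp add: mult.assoc)
  qed
  then show ?thesis unfolding lip_bound_def by (simp add: mult.assoc)
qed

lemma approximable_q_integral:
  assumes "approximable q f" and w: "w \<ge> 1"
  shows "approximable q (q_integral w f)"
  unfolding approximable_def
proof (intro allI impI)
  fix \<epsilon> :: real assume "\<epsilon> > 0"
  \<comment> \<open>Integration multiplies the norm of the error by at most \<open>p\<close>, and
    sends the approximant to an exponential polynomial.\<close>
  then have "\<epsilon> / real p > 0" using p_gt_1 by simp
  then obtain e where e: "exp_poly q e" "lip_bound (\<epsilon> / real p) (\<lambda>m. f m - e m)"
    using assms unfolding approximable_def by meson
  have "approximable q (\<lambda>m. f m - e m)"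
    by (intro approximable_diff assms approximable_exp_poly e)
  from lip_bound_q_integral[OF e(2) this w]
  have "lip_bound \<epsilon> (\<lambda>m. q_integral w f m - q_integral w e m)"
    using p_gt_1
    by (simp add: q_integral_diff[OF assms(1) approximable_exp_poly[OF e(1)] w, abs_def])
  with exp_poly_q_integral[OF e(1) w]
  show "\<exists>e. exp_poly q e \<and> lip_bound \<epsilon> (\<lambda>m. q_integral w f m - e m)" by blast
qed

section \<open>The symmetric operator\<close>

text \<open>The prefactor is 1/[b]_q. Here \<open>b\<close> is both the number of summands and the
  parameter of the measure, while \<open>a\<close> is the step of the summation.\<close>

definition sum_integral :: "nat \<Rightarrow> nat \<Rightarrow> (nat \<Rightarrow> 'a) \<Rightarrow> nat \<Rightarrow> 'a" where
  "sum_integral a b f m = (1 - q) / (1 - q ^ b) * (\<Sum>j<b. q ^ (a * j) * q_integral b f (m + a * j))"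

text \<open>The integral contributes \<open>1 - q ^ b\<close> in the numerator, cancelling the
  prefactor's denominator. The sum over \<open>j\<close> is geometric with ratio q^(a(k+1)) and
  \<open>b\<close> terms, which produces the symmetric factor 1 - q^(ab(k+1)).\<close>

lemma sum_integral_monomial:
  assumes "a \<ge> 1" "b \<ge> 1"
  shows "sum_integral a b (\<lambda>m. c * q ^ (k * m)) m
    = c * (of_nat (Suc k) * (1 - q) * (1 - q ^ (a * b * Suc k))
        / ((1 - q ^ (a * Suc k)) * (1 - q ^ (b * Suc k)))) * q ^ (k * m)"
proof -
  have nz: "1 - q ^ (a * Suc k) \<noteq> 0" "1 - q ^ b \<noteq> 0"
    using assms q_power_eq_1_iff[of "a * Suc k"] q_power_eq_1_iff[of b] by auto
  define C where "C = c * (of_nat (Suc k) * (1 - q ^ b) / (1 - q ^ (b * Suc k)))"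
  have "(\<Sum>j<b. q ^ (a * j) * q_integral b (\<lambda>m. c * q ^ (k * m)) (m + a * j))
      = C * q ^ (k * m) * (\<Sum>j<b. (q ^ (a * Suc k)) ^ j)"
    unfolding q_integral_monomial[OF assms(2)] sum_distrib_left C_def
    by (intro sum.cong refl) (simp add: algebra_simps flip: power_mult power_add)
  also have "(\<Sum>j<b. (q ^ (a * Suc k)) ^ j) = (1 - q ^ (a * b * Suc k)) / (1 - q ^ (a * Suc k))"
  proof -
    have "1 - q ^ (a * b * Suc k) = (1 - q ^ (a * Suc k)) * (\<Sum>j<b. (q ^ (a * Suc k)) ^ j)"
      using one_diff_power_eq[of "q ^ (a * Suc k)" b]
      by (simp only: power_mult[symmetric] ac_simps)
    then show ?thesis using nz(1) by simp
  qed
  finally show ?thesis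
    using nz(2) unfolding sum_integral_def C_def by (simp add: mult_ac)
qed

lemma approximable_sum_integral:
  assumes "approximable q f" "b \<ge> 1"
  shows "approximable q (sum_integral a b f)"
  unfolding sum_integral_def[abs_def]
  by (intro approximable_cmult approximable_sum approximable_shift approximable_q_integral assms)

lemma sum_integral_add:
  assumes "approximable q f" "approximable q g" "b \<ge> 1"
  shows "sum_integral a b (\<lambda>m. f m + g m) m = sum_integral a b f m + sum_integral a b g m"
  by (simp add: sum_integral_def q_integral_add[OF assms] distrib_left sum.distrib)

lemma sum_integral_diff:
  assumes "approximable q f" "approximable q g" "b \<ge> 1"
  shows "sum_integral a b (\<lambda>m. f m - g m) m = sum_integral a b f m - sum_integral a b g m"
  by (simp add: sum_integral_def q_integral_diff[OF assms] right_diff_distrib sum_subtractf)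

lemma sum_integral_le:
  assumes "lip_bound B f" "approximable q f" "b \<ge> 1"
  shows "absval (sum_integral a b f m) \<le> absval ((1 - q) / (1 - q ^ b)) * (real p * B)"
proof -
  have "absval (q ^ (a * j) * q_integral b f (m + a * j)) \<le> real p * B" for j
    using q_integral_le[OF assms, of "m + a * j"] by (simp add: absval_mult absval_power absval_q)
  then show ?thesis
    unfolding sum_integral_def absval_mult[of "(1 - q) / (1 - q ^ b)"]
    using lip_bound_nonneg[OF assms(1)] by (intro mult_left_mono absval_sum_le) auto
qed

lemma sum_integral_commute_exp_poly:
  assumes "exp_poly q f" "a \<ge> 1" "b \<ge> 1"
  shows "sum_integral a b f m = sum_integral b a f m"
  using assms(1)
proof (induction rule: exp_poly.induct)
  case (monomial c k)
  show ?case
    unfolding sum_integral_monomial[OF assms(2,3)] sum_integral_monomial[OF assms(3,2)]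
    by (simp only: mult.commute[of b a] mult.commute[of "1 - q ^ (b * Suc k)"])
next
  case (add f g)
  then show ?case
    by (simp add: sum_integral_add[OF _ _ assms(2)] sum_integral_add[OF _ _ assms(3)]
        approximable_exp_poly)
qed

text \<open>The two operators agree on the approximant \<open>e\<close>, so their difference at
  \<open>f\<close> comes only from \<open>f - e\<close>, where both are small.\<close>

lemma sum_integral_commute:
  assumes f: "approximable q f" and "a \<ge> 1" "b \<ge> 1"
  shows "sum_integral a b f = sum_integral b a f"
proof
  fix m
  \<comment> \<open>A common operator bound for both orders of \<open>a\<close> and
    \<open>b\<close>.\<close>
  define C where "C = real p * max (absval ((1 - q) / (1 - q ^ b))) (absval ((1 - q) / (1 - q ^ a)))"
  have C: "C \<ge> 0" by (simp add: C_def le_max_iff_disj)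
  have le: "absval (sum_integral a b f m - sum_integral b a f m) \<le> C * \<epsilon>" if eps: "\<epsilon> > 0" for \<epsilon>
  proof -
    obtain e where e: "exp_poly q e" "lip_bound \<epsilon> (\<lambda>m. f m - e m)"
      using f eps unfolding approximable_def by meson
    note e' = approximable_exp_poly[OF e(1)]
    have "absval (sum_integral a b (\<lambda>m. f m - e m) m) \<le> C * \<epsilon>"
      by (rule order_trans[OF sum_integral_le[OF e(2) approximable_diff[OF f e'] assms(3)]])
        (use eps p_gt_1 in \<open>simp add: C_def\<close>)
    moreover have "absval (sum_integral b a (\<lambda>m. f m - e m) m) \<le> C * \<epsilon>"
      by (rule order_trans[OF sum_integral_le[OF e(2) approximable_diff[OF f e'] assms(2)]])
        (use eps p_gt_1 in \<open>simp add: C_def\<close>)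
    ultimately show ?thesis
      using absval_diff_le sum_integral_commute_exp_poly[OF e(1) assms(2,3), of m]
      unfolding sum_integral_diff[OF f e' assms(2)] sum_integral_diff[OF f e' assms(3)]
      by fastforce
  qed
  have "absval (sum_integral a b f m - sum_integral b a f m) \<le> 0"
  proof (rule field_le_epsilon)
    fix \<epsilon> :: real assume "\<epsilon> > 0"
    \<comment> \<open>Dividing by \<open>C + 1\<close> requires only
      \<open>C \<ge> 0\<close>.\<close>
    have "C * (\<epsilon> / (C + 1)) \<le> \<epsilon>"
      using C \<open>\<epsilon> > 0\<close> by (simp add: field_simps)
    with le[of "\<epsilon> / (C + 1)"] C \<open>\<epsilon> > 0\<close>
    show "absval (sum_integral a b f m - sum_integral b a f m) \<le> 0 + \<epsilon>" by simp
  qed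
  then show "sum_integral a b f m = sum_integral b a f m"
    using absval_nonneg[of "sum_integral a b f m - sum_integral b a f m"]
    by (metis absval_eq_0_iff antisym eq_iff_diff_eq_0)
qed

section \<open>Iterating the operator \<open>r\<close> times\<close>

lemma approximable_funpow_sum_integral:
  "approximable q f \<Longrightarrow> b \<ge> 1 \<Longrightarrow> approximable q ((sum_integral a b ^^ r) f)"
  by (induction r) (auto intro: approximable_sum_integral)

lemma approximable_funpow_q_integral:
  "approximable q f \<Longrightarrow> b \<ge> 1 \<Longrightarrow> approximable q ((q_integral b ^^ r) f)"
  by (induction r) (auto intro: approximable_q_integral)

lemma funpow_sum_integral_commute:
  assumes "approximable q f" "a \<ge> 1" "b \<ge> 1"
  shows "(sum_integral a b ^^ r) f = (sum_integral b a ^^ r) f"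
proof (induction r)
  case (Suc r)
  have "approximable q ((sum_integral a b ^^ r) f)"
    by (rule approximable_funpow_sum_integral[OF assms(1,3)])
  then show ?case
    using Suc sum_integral_commute[OF _ assms(2,3)] by simp
qed simp

lemma sum_lists_length_Suc:
  fixes h :: "nat list \<Rightarrow> 'b::comm_monoid_add"
  shows "(\<Sum>js | set js \<subseteq> {..<b} \<and> length js = Suc r. h js)
    = (\<Sum>j<b. \<Sum>js | set js \<subseteq> {..<b} \<and> length js = r. h (j # js))"
proof -
  let ?L = "{js. set js \<subseteq> {..<b} \<and> length js = r}"
  have eq: "{js. set js \<subseteq> {..<b} \<and> length js = Suc r} = (\<lambda>(j, js). j # js) ` ({..<b} \<times> ?L)"
    by (auto simp: image_iff length_Suc_conv)
  have "inj_on (\<lambda>(j, js). j # js) ({..<b} \<times> ?L)"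
    by (auto simp: inj_on_def)
  then show ?thesis
    unfolding eq sum.cartesian_product by (subst sum.reindex) (auto intro!: sum.cong)
qed

text \<open>Integrals pass through finite sums and translations, so performing all integrals before
  all sums equals \<open>r\<close> rounds of one integral and one sum. Peeling off the first index
  \<open>j\<close> moves the base point by \<open>a * j\<close>, hence the induction is over all
  \<open>m\<close>.\<close>

lemma sum_q_integral_eq_sum_integral:
  assumes f: "approximable q f" and b: "b \<ge> 1"
  shows "((1 - q) / (1 - q ^ b)) ^ r *
      (\<Sum>js | set js \<subseteq> {..<b} \<and> length js = r.
         q ^ (a * sum_list js) * (q_integral b ^^ r) f (m + a * sum_list js))
    = (sum_integral a b ^^ r) f m"
proof (induction r arbitrary: m)
  case 0
  have "{js::nat list. set js \<subseteq> {..<b} \<and> length js = 0} = {[]}" by auto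
  then show ?case by simp
next
  case (Suc r)
  let ?L = "{js. set js \<subseteq> {..<b} \<and> length js = r}"
  define c where "c = (1 - q) / (1 - q ^ b)"
  define g where "g = (q_integral b ^^ r) f"
  have g: "approximable q g"
    unfolding g_def by (rule approximable_funpow_q_integral[OF f b])
  \<comment> \<open>The induction hypothesis is used as an identity of functions of
    \<open>m\<close>; the remaining integral is then taken outside the inner sum.\<close>
  have inner: "c ^ r * (\<Sum>js\<in>?L. q ^ (a * sum_list js) * q_integral b g (m + a * sum_list js))
      = q_integral b ((sum_integral a b ^^ r) f) m" for m
  proof -
    have app: "approximable q (\<lambda>m. q ^ (a * sum_list js) * g (m + a * sum_list js))" for js
      by (intro approximable_cmult approximable_shift g)
    have "(sum_integral a b ^^ r) f
        = (\<lambda>m. c ^ r * (\<Sum>js\<in>?L. q ^ (a * sum_list js) * g (m + a * sum_list js)))"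
      unfolding Suc.IH[symmetric] c_def g_def ..
    then show ?thesis
      by (simp add: q_integral_cmult[OF approximable_sum[OF app] b] q_integral_sum[OF app b]
          q_integral_cmult[OF approximable_shift[OF g] b] q_integral_shift)
  qed
  have "c ^ Suc r * (\<Sum>js | set js \<subseteq> {..<b} \<and> length js = Suc r.
         q ^ (a * sum_list js) * (q_integral b ^^ Suc r) f (m + a * sum_list js))
      = c * (\<Sum>j<b. q ^ (a * j) * (c ^ r * (\<Sum>js\<in>?L.
          q ^ (a * sum_list js) * q_integral b g (m + a * j + a * sum_list js))))"
    unfolding sum_lists_length_Suc
    by (simp add: g_def sum_distrib_left power_add distrib_left mult_ac add_ac)
  also have "\<dots> = (sum_integral a b ^^ Suc r) f m"
    unfolding inner by (simp add: sum_integral_def c_def)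
  finally show ?case unfolding c_def .
qed

section \<open>Translation of the integrals\<close>

lemma q_number_of_nat: "q_number (q ^ w) (of_nat n) = (1 - (q ^ w) ^ n) / (1 - q ^ w)"
  by (simp add: q_number_def padic_power_of_nat[OF q_power_ball])

text \<open>The defining limits sample \<open>F\<close> only at natural numbers. Fixing the
  outermost, last variable at \<open>n\<close> moves the base point of the inner integrals by
  \<open>w * n\<close>.\<close>

lemma padic_q_multi_integral_eq:
  assumes "\<And>ns. length ns = r \<Longrightarrow> F (map of_nat ns) = f (m + w * sum_list ns)"
  shows "padic_q_multi_integral p (q ^ w) r F = (q_integral w ^^ r) f m"
  using assms
proof (induction r arbitrary: F m)
  case 0
  then show ?case using 0[of "[]"] by simp
next
  case (Suc r)
  have "padic_q_multi_integral p (q ^ w) r (\<lambda>ys. F (ys @ [of_nat n]))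
      = (q_integral w ^^ r) f (m + w * n)" for n
  proof (rule Suc.IH)
    fix ns :: "nat list" assume "length ns = r"
    then show "F (map of_nat ns @ [of_nat n]) = f (m + w * n + w * sum_list ns)"
      using Suc.prems[of "ns @ [n]"] by (simp add: distrib_left add_ac)
  qed
  then have "padic_q_multi_integral p (q ^ w) (Suc r) F
      = lim (riemann_sum w ((q_integral w ^^ r) f) m)"
    by (simp add: padic_q_integral_def riemann_sum_def[abs_def] q_number_of_nat
        flip: power_mult of_nat_power)
  then show ?case by (simp add: q_integral_def[of w "(q_integral w ^^ r) f"])
qed

text \<open>Truncating the series gives the approximants: every term is a polynomial in a q-number,
  and its norm is at most |t^n/n!|, so the tail is small in norm and not only pointwise.\<close>

lemma approximable_degen_exp:
  fixes lam t z :: 'a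
  assumes lam: "absval lam \<le> 1" and t: "absval t < radius" and z: "z \<in> padic_integers"
  shows "approximable q (\<lambda>m. degen_exp lam t (q_number q (z + of_nat m)))"
proof -
  define c where "c = padic_power q z"
  define A where "A m = q_number q (z + of_nat m)" for m
  define u where "u n m = degen_falling lam (A m) n * (t ^ n / fact n)" for n m
  \<comment> \<open>This is [z + m]_q = [z]_q + q^z [m]_q.\<close>
  have A: "A = (\<lambda>m. (1 - c) / (1 - q) + c * ((1 - q ^ m) / (1 - q)))"
    unfolding A_def[abs_def] q_number_def padic_power_add_of_nat[OF q_ball z] c_def[symmetric]
    by (auto simp: right_diff_distrib simp flip: add_divide_distrib)
  have c: "absval (1 - c) \<le> absval (1 - q)"
    unfolding c_def by (rule absval_one_minus_padic_power[OF q_ball z])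
  then have c1: "absval c = 1"
    using absval_eqI_dominant[of c 1] absval_minus_commute[of c 1] q_ball radius(2) by simp
  have "lip_bound 1 A"
  proof (rule lip_boundI)
    fix m
    have "absval (1 - q ^ m) \<le> absval (1 - q)"
      unfolding absval_one_minus_power[OF q_ball]
      by (intro mult_left_le_one_le absval_of_nat_le) auto
    with c show "absval (A m) \<le> 1"
      unfolding A using q_ne_1 by (intro absval_add_le) (auto simp: absval_mult absval_divide c1)
  next
    fix h
    \<comment> \<open>The first difference is a multiple of \<open>q ^ m\<close> by a coefficient of
      absolute value |h|, so all higher differences follow from the bound for powers of
      \<open>q\<close>.\<close>
    have "shift_diff h A = (\<lambda>m. (c * (1 - q ^ h) / (1 - q)) * q ^ m)"
    proof
      fix m
      have "shift_diff h A m = c * ((1 - q ^ (m + h)) / (1 - q) - (1 - q ^ m) / (1 - q))"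
        by (simp add: shift_diff_def A right_diff_distrib)
      also have "(1 - q ^ (m + h)) / (1 - q) - (1 - q ^ m) / (1 - q) = q ^ m * (1 - q ^ h) / (1 - q)"
        by (simp add: power_add right_diff_distrib flip: diff_divide_distrib)
      finally show "shift_diff h A m = (c * (1 - q ^ h) / (1 - q)) * q ^ m"
        by (simp add: mult_ac)
    qed
    moreover have "absval (c * (1 - q ^ h) / (1 - q)) = absval (of_nat h :: 'a)"
      using q_ne_1 by (simp add: absval_mult absval_divide c1 absval_one_minus_power[OF q_ball])
    ultimately show "lip_bound (1 * absval (of_nat h :: 'a)) (shift_diff h A)"
      using lip_bound_cmult[OF lip_bound_q_power, of "c * (1 - q ^ h) / (1 - q)"] by simp
  qed
  moreover have "lip_bound 1 (\<lambda>_. of_nat i * lam)" for i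
    using mult_mono[OF absval_of_nat_le[of i, where ?'a = 'a] lam]
    by (intro lip_bound_mono[OF lip_bound_const]) (simp add: absval_mult)
  ultimately have "lip_bound 1 (\<lambda>m. degen_falling lam (A m) n)" for n
    unfolding degen_falling_def by (intro lip_bound_prod lip_bound_diff)
  from lip_bound_cmult[OF this]
  have lip_u: "lip_bound (absval (t ^ n / fact n)) (u n)" for n
    unfolding u_def[abs_def] by (simp only: mult.commute[of "degen_falling _ _ _"] mult_1_right)
  have "exp_poly q A"
  proof -
    have "A = (\<lambda>m. 1 / (1 - q) + (- c / (1 - q)) * q ^ (1 * m))"
      unfolding A using q_ne_1 by (auto simp: field_simps)
    then show ?thesis by (simp only: exp_poly.add exp_poly_const exp_poly.monomial)
  qed
  then have "exp_poly q (\<lambda>m. A m - of_nat i * lam)" for i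
    using exp_poly.add[OF _ exp_poly_const[of q "- (of_nat i * lam)"]] by simp
  then have exp_u: "exp_poly q (u n)" for n
    unfolding u_def[abs_def] degen_falling_def
    by (intro exp_poly_mult exp_poly_prod exp_poly_const)
  note lim0 = power_over_fact_tendsto_0[OF t]
  have "summable (\<lambda>n. u n m)" for m
  proof (rule nonarch_summable, rule Lim_null_comparison[OF _ lim0])
    show "\<forall>\<^sub>F n in sequentially. norm (absval (u n m)) \<le> absval (t ^ n / fact n)"
      using lip_boundD[OF lip_u] by simp
  qed
  then have lim: "(\<lambda>k. \<Sum>n<k. u n m) \<longlonglongrightarrow> degen_exp lam t (A m)" for m
    unfolding degen_exp_def u_def by (rule summable_LIMSEQ)
  show ?thesis
    unfolding approximable_def A_def[symmetric]
  proof (intro allI impI)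
    fix \<epsilon> :: real assume "\<epsilon> > 0"
    then obtain k where k: "\<And>n. n \<ge> k \<Longrightarrow> absval (t ^ n / fact n) < \<epsilon>"
      using order_tendstoD(2)[OF lim0, of \<epsilon>] by (auto simp: eventually_sequentially)
    have "lip_bound \<epsilon> (\<lambda>m. degen_exp lam t (A m) - (\<Sum>n<k. u n m))"
    proof (rule lip_bound_limit)
      \<comment> \<open>Starting the partial sums at \<open>k\<close> makes every member of the
        sequence a block of terms beyond \<open>k\<close>, so the bound holds for all
        \<open>i\<close>.\<close>
      show "(\<lambda>i. (\<Sum>n<i + k. u n m) - (\<Sum>n<k. u n m))
          \<longlonglongrightarrow> degen_exp lam t (A m) - (\<Sum>n<k. u n m)" for m
        by (intro tendsto_diff tendsto_const LIMSEQ_ignore_initial_segment lim)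
      fix i
      have "(\<Sum>n<i + k. u n m) - (\<Sum>n<k. u n m) = (\<Sum>n=k..<i + k. u n m)" for m
        using sum_diff_nat_ivl[of 0 k "i + k" "\<lambda>n. u n m"] by (simp add: lessThan_atLeast0)
      moreover have "lip_bound \<epsilon> (\<lambda>m. \<Sum>n=k..<i + k. u n m)"
        using k \<open>\<epsilon> > 0\<close>
        by (intro lip_bound_sum) (auto intro: lip_bound_mono[OF lip_u] less_imp_le)
      ultimately show "lip_bound \<epsilon> (\<lambda>m. (\<Sum>n<i + k. u n m) - (\<Sum>n<k. u n m))"
        by simp
    qed
    moreover have "exp_poly q (\<lambda>m. \<Sum>n<k. u n m)"
      by (intro exp_poly_sum exp_u)
    ultimately show "\<exists>e. exp_poly q e \<and> lip_bound \<epsilon> (\<lambda>m. degen_exp lam t (A m) - e m)"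
      by blast
  qed
qed

text \<open>Expresses one side of the identity through the operator: the common argument starts at
  the base point 0, and \<open>f\<close> is the restriction of \<open>G\<close> to the natural
  numbers.\<close>

lemma sum_multi_integral_eq:
  fixes G :: "'a \<Rightarrow> 'a"
  assumes f: "approximable q f" and b: "b \<ge> 1"
    and G: "\<And>m. G (of_nat m) = f m"
  shows "1 / q_number q (of_nat b) ^ r *
       (\<Sum>js | set js \<subseteq> {..<b} \<and> length js = r. q ^ (a * sum_list js) *
          padic_q_multi_integral p (q ^ b) r
            (\<lambda>ys. G (of_nat a * of_nat (sum_list js) + of_nat b * sum_list ys)))
     = (sum_integral a b ^^ r) f 0"
proof -
  have sum_map: "sum_list (map of_nat ns) = (of_nat (sum_list ns) :: 'a)" for ns
    by (induction ns) auto
  have "padic_q_multi_integral p (q ^ b) r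
        (\<lambda>ys. G (of_nat a * of_nat (sum_list js) + of_nat b * sum_list ys))
      = (q_integral b ^^ r) f (0 + a * sum_list js)" for js
    by (rule padic_q_multi_integral_eq) (simp add: sum_map flip: G)
  moreover have "1 / q_number q (of_nat b) ^ r = ((1 - q) / (1 - q ^ b)) ^ r"
    using q_number_of_nat[of 1 b] by (simp add: power_divide)
  ultimately show ?thesis
    using sum_q_integral_eq_sum_integral[OF f b, of r a 0] by simp
qed

end

theorem theorem1:
  fixes p r w1 w2 :: nat
    and q lam t x :: "'a::nonarch_complete_field"
  assumes "prime p" and "odd p"
    and "padic_complex p TYPE('a)"
    and "q \<noteq> 1" and "absval (1 - q) < real p powr (- 1 / (real p - 1))"
    and "absval lam \<le> 1" and "absval t < real p powr (- 1 / (real p - 1))"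
    and "r \<ge> 1" and "x \<in> padic_integers"
    and "w1 \<ge> 1" and "w2 \<ge> 1"
  shows
    "1 / q_number q (of_nat w2) ^ r *
       (\<Sum>js | set js \<subseteq> {..<w2} \<and> length js = r.
          q ^ (w1 * sum_list js) *
          padic_q_multi_integral p (q ^ w2) r
            (\<lambda>ys. degen_exp lam t
               (q_number q (of_nat w1 * of_nat w2 * x + of_nat w1 * of_nat (sum_list js)
                              + of_nat w2 * sum_list ys))))
     = 1 / q_number q (of_nat w1) ^ r *
       (\<Sum>js | set js \<subseteq> {..<w1} \<and> length js = r.
          q ^ (w2 * sum_list js) *
          padic_q_multi_integral p (q ^ w1) r
            (\<lambda>ys. degen_exp lam t
               (q_number q (of_nat w1 * of_nat w2 * x + of_nat w2 * of_nat (sum_list js)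
                              + of_nat w1 * sum_list ys))))"
proof -
  interpret padic_base p "TYPE('a)"
    using assms(1,3) by unfold_locales (auto simp: padic_complex_def)
  interpret padic_q p "TYPE('a)" q
    using assms(4,5) by unfold_locales (auto simp: radius_def)
  \<comment> \<open>The part of the argument common to both sides is absorbed into one function
    \<open>G\<close>; the sides then differ only by exchanging \<open>w1\<close> and
    \<open>w2\<close> in the operator.\<close>
  define z where "z = of_nat w1 * of_nat w2 * x"
  define G where "G y = degen_exp lam t (q_number q (z + y))" for y
  have "z \<in> padic_integers"
    unfolding z_def of_nat_mult[symmetric] by (rule padic_integers_of_nat_mult[OF assms(9)])
  then have f: "approximable q (\<lambda>m. G (of_nat m))"
    unfolding G_def using assms(6,7) by (intro approximable_degen_exp) (auto simp: radius_def)
  show ?thesis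
    using sum_multi_integral_eq[OF f assms(11) refl, of r w1]
      sum_multi_integral_eq[OF f assms(10) refl, of r w2]
      funpow_sum_integral_commute[OF f assms(10,11), of r]
    by (simp only: G_def z_def[symmetric] add.assoc)
qed

end
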